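(* Let $A$ be a formula with $\dim[\![A]\!]\ge2$. The function $\{0,1\}^*\to[\![\mathbf{bint}_A]\!]$ which maps $S$ to $[\![\underline{S}_A]\!]$ is injective.
   Context: $k$ is an algebraically closed field of characteristic zero. Formulas are those of propositional intuitionistic linear logic with connectives $\otimes,\&,\multimap,!$. The *Sweedler semantics* $[\![-]\!]$: chosen vector spaces for atoms, $[\![A\otimes B]\!]=[\![A]\!]\otimes[\![B]\!]$, $[\![A\&B]\!]=[\![A]\!]\oplus[\![B]\!]$, $[\![A\multimap B]\!]=\mathrm{Hom}_k([\![A]\!],[\![B]\!])$, $[\![!A]\!]={!}[\![A]\!]$, where $!V$ is the universal (cofree) cocommutative coassociative counital coalgebra with universal linear map $d:{!}V\to V$. Proofs denote linear maps in the standard way: dereliction is $d$, contraction is comultiplication, weakening is the counit, promotion is the unique lift to a coalgebra morphism, cut is composition; a proof of $\vdash B$ denotes an element of $[\![B]\!]$. For $P\in V$, $|\emptyset\rangle_P\in{!}V$ is the unique group-like element with $d|\emptyset\rangle_P=P$. With $E=A\multimap A$, $\mathbf{bint}_A={!}E\multimap({!}E\multimap E)$. For $S=s_1\cdots s_l\in\{0,1\}^*$, the binary integer $\underline{S}_A$ is the proof of $\mathbf{bint}_A$ given by the term $\lambda!u_0.\lambda!u_1.\lambda a.\,u_{s_l}(\cdots u_{s_1}(a)\cdots)$ (each occurrence derelicted, occurrences of each $u_i$ contracted together, weakening if there are none). Its denotation is regarded as a linear map ${!}V\otimes{!}V\to V$, $V=\mathrm{End}_k([\![A]\!])$, sending $|\emptyset\rangle_{\alpha_0}\otimes|\emptyset\rangle_{\alpha_1}$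 to $\alpha_{s_l}\circ\cdots\circ\alpha_{s_1}$. *)

theory Defs
  imports Complex_Main "HOL-Library.FuncSet" "HOL-Computational_Algebra.Polynomial"
begin

text \<open>
  Vector spaces are subspaces of one ambient vector space of type \<open>'u\<close> with scalar multiplication
  \<open>s\<close>. Both \<open>'u\<close> and \<open>s\<close> are arbitrary, and any set of vector spaces embeds in such an ambient
  space (their direct sum), so up to isomorphism this is no restriction; the ambient space plays
  the role of a universe. Tensor products, direct sums, spaces of linear maps and cofree
  coalgebras are specified by their defining properties, that is, up to unique isomorphism.
\<close>

section \<open>Linear algebra on subspaces\<close>

text \<open>Linear maps are extensional functions, so that they are determined by their values on \<open>V\<close>.\<close>

definition linmaps ::
  "('k::field \<Rightarrow> 'a::ab_group_add \<Rightarrow> 'a) \<Rightarrow> ('k \<Rightarrow> 'b::ab_group_add \<Rightarrow> 'b) \<Rightarrow> 'a set \<Rightarrow> 'b set \<Rightarrow> ('a \<Rightarrow> 'b) set"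
where
  "linmaps s t V W = {f \<in> V \<rightarrow>\<^sub>E W.
     (\<forall>x\<in>V. \<forall>y\<in>V. f (x + y) = f x + f y) \<and> (\<forall>c. \<forall>x\<in>V. f (s c x) = t c (f x))}"

definition bilinear_on ::
  "('k::field \<Rightarrow> 'u::ab_group_add \<Rightarrow> 'u) \<Rightarrow> 'u set \<Rightarrow> 'u set \<Rightarrow> 'u set \<Rightarrow> ('u \<Rightarrow> 'u \<Rightarrow> 'u) \<Rightarrow> bool"
where
  "bilinear_on s V W X \<beta> \<longleftrightarrow>
     (\<forall>v\<in>V. (\<lambda>w\<in>W. \<beta> v w) \<in> linmaps s s W X) \<and>
     (\<forall>w\<in>W. (\<lambda>v\<in>V. \<beta> v w) \<in> linmaps s s V X)"

definition multilinear_on ::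
  "('k::field \<Rightarrow> 'u::ab_group_add \<Rightarrow> 'u) \<Rightarrow> 'u set list \<Rightarrow> 'u set \<Rightarrow> ('u list \<Rightarrow> 'u) \<Rightarrow> bool"
where
  "multilinear_on s Vs W g \<longleftrightarrow> g \<in> listset Vs \<rightarrow> W \<and>
     (\<forall>xs\<in>listset Vs. \<forall>i<length Vs. (\<lambda>x\<in>Vs ! i. g (xs[i := x])) \<in> linmaps s s (Vs ! i) W)"

text \<open>The cardinality of a basis of \<open>V\<close> is at least \<open>n\<close>. (The library's \<open>dim\<close> is \<open>0\<close> on
  infinite-dimensional spaces, which must be allowed here.)\<close>

definition dim_ge :: "('k::field \<Rightarrow> 'u::ab_group_add \<Rightarrow> 'u) \<Rightarrow> nat \<Rightarrow> 'u set \<Rightarrow> bool" where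
  "dim_ge s n V \<longleftrightarrow> (\<exists>B\<subseteq>V. \<not> module.dependent s B \<and> module.span s B = V \<and> (infinite B \<or> n \<le> card B))"

definition is_tensor ::
  "('k::field \<Rightarrow> 'u::ab_group_add \<Rightarrow> 'u) \<Rightarrow> 'u set \<Rightarrow> 'u set \<Rightarrow> 'u set \<Rightarrow> ('u \<Rightarrow> 'u \<Rightarrow> 'u) \<Rightarrow> bool"
where
  "is_tensor s V W T \<tau> \<longleftrightarrow>
     module.subspace s T \<and> bilinear_on s V W T \<tau> \<and>
     (\<forall>X \<beta>. module.subspace s X \<and> bilinear_on s V W X \<beta> \<longrightarrow>
        (\<exists>!g. g \<in> linmaps s s T X \<and> (\<forall>v\<in>V. \<forall>w\<in>W. g (\<tau> v w) = \<beta> v w)))"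

text \<open>The linear map on the tensor product \<open>(T, \<tau>)\<close> induced by a bilinear map \<open>\<beta>\<close>.\<close>

definition tensor_lift ::
  "('k::field \<Rightarrow> 'u::ab_group_add \<Rightarrow> 'u) \<Rightarrow> 'u set \<Rightarrow> 'u set \<Rightarrow> 'u set \<Rightarrow> ('u \<Rightarrow> 'u \<Rightarrow> 'u) \<Rightarrow>
     ('u \<Rightarrow> 'u \<Rightarrow> 'u) \<Rightarrow> 'u \<Rightarrow> 'u"
where
  "tensor_lift s V W T \<tau> \<beta> =
     (THE g. g \<in> linmaps s s T UNIV \<and> (\<forall>v\<in>V. \<forall>w\<in>W. g (\<tau> v w) = \<beta> v w))"

definition is_direct_sum ::
  "('k::field \<Rightarrow> 'u::ab_group_add \<Rightarrow> 'u) \<Rightarrow> 'u set \<Rightarrow> 'u set \<Rightarrow> 'u set \<Rightarrow> ('u \<Rightarrow> 'u) \<Rightarrow> ('u \<Rightarrow> 'u) \<Rightarrow> bool"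
where
  "is_direct_sum s V W S p q \<longleftrightarrow>
     module.subspace s S \<and> restrict p S \<in> linmaps s s S V \<and> restrict q S \<in> linmaps s s S W \<and>
     bij_betw (\<lambda>x. (p x, q x)) S (V \<times> W)"

text \<open>\<open>H\<close> is the space of all linear maps from \<open>V\<close> to \<open>W\<close>, the element \<open>h\<close> standing for \<open>ev h\<close>.\<close>

definition is_hom_space ::
  "('k::field \<Rightarrow> 'u::ab_group_add \<Rightarrow> 'u) \<Rightarrow> 'u set \<Rightarrow> 'u set \<Rightarrow> 'u set \<Rightarrow> ('u \<Rightarrow> 'u \<Rightarrow> 'u) \<Rightarrow> bool"
where
  "is_hom_space s V W H ev \<longleftrightarrow>
     module.subspace s H \<and> bij_betw ev H (linmaps s s V W) \<and>
     (\<forall>g\<in>H. \<forall>h\<in>H. \<forall>x\<in>V. ev (g + h) x = ev g x + ev h x) \<and>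
     (\<forall>c. \<forall>h\<in>H. \<forall>x\<in>V. ev (s c h) x = s c (ev h x))"


section \<open>Coalgebras\<close>

text \<open>\<open>sq\<close> with \<open>tn\<close> is the tensor square of the carrier, in which \<open>comul\<close> takes its values.\<close>

record ('k, 'u) coalgebra =
  car :: "'u set"
  sq :: "'u set"
  tn :: "'u \<Rightarrow> 'u \<Rightarrow> 'u"
  comul :: "'u \<Rightarrow> 'u"
  counit :: "'u \<Rightarrow> 'k"

text \<open>In Sweedler notation, \<open>sweedler_sum s C \<beta> x\<close> is the sum of \<open>\<beta> x\<^sub>(\<^sub>1\<^sub>) x\<^sub>(\<^sub>2\<^sub>)\<close>, where the
  comultiplication sends \<open>x\<close> to the sum of \<open>x\<^sub>(\<^sub>1\<^sub>) \<otimes> x\<^sub>(\<^sub>2\<^sub>)\<close>.\<close>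

definition sweedler_sum ::
  "('k::field \<Rightarrow> 'u::ab_group_add \<Rightarrow> 'u) \<Rightarrow> ('k, 'u) coalgebra \<Rightarrow> ('u \<Rightarrow> 'u \<Rightarrow> 'u) \<Rightarrow> 'u \<Rightarrow> 'u"
where
  "sweedler_sum s C \<beta> x = tensor_lift s (car C) (car C) (sq C) (tn C) \<beta> (comul C x)"

text \<open>The last four conjuncts are the counit laws, cocommutativity and coassociativity; the latter
  is an equation in the space \<open>L\<close>, the tensor product of \<open>sq C\<close> and \<open>car C\<close>.\<close>

definition cocomm_coalgebra ::
  "('k::field \<Rightarrow> 'u::ab_group_add \<Rightarrow> 'u) \<Rightarrow> ('k, 'u) coalgebra \<Rightarrow> bool"
where
  "cocomm_coalgebra s C \<longleftrightarrow>
     module.subspace s (car C) \<and>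
     is_tensor s (car C) (car C) (sq C) (tn C) \<and>
     restrict (comul C) (car C) \<in> linmaps s s (car C) (sq C) \<and>
     restrict (counit C) (car C) \<in> linmaps s (*) (car C) UNIV \<and>
     (\<forall>x\<in>car C. sweedler_sum s C (\<lambda>a b. s (counit C a) b) x = x) \<and>
     (\<forall>x\<in>car C. sweedler_sum s C (\<lambda>a b. s (counit C b) a) x = x) \<and>
     (\<forall>x\<in>car C. sweedler_sum s C (\<lambda>a b. tn C b a) x = comul C x) \<and>
     (\<exists>L \<sigma>. is_tensor s (sq C) (car C) L \<sigma> \<and>
        (\<forall>x\<in>car C. sweedler_sum s C (\<lambda>a b. \<sigma> (comul C a) b) x =
           sweedler_sum s C (\<lambda>a b. sweedler_sum s C (\<lambda>b' b''. \<sigma> (tn C a b') b'') b) x))"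

definition coalg_morphisms ::
  "('k::field \<Rightarrow> 'u::ab_group_add \<Rightarrow> 'u) \<Rightarrow> ('k, 'u) coalgebra \<Rightarrow> ('k, 'u) coalgebra \<Rightarrow> ('u \<Rightarrow> 'u) set"
where
  "coalg_morphisms s C D = {\<phi> \<in> linmaps s s (car C) (car D).
     (\<forall>x\<in>car C. counit D (\<phi> x) = counit C x) \<and>
     (\<forall>x\<in>car C. comul D (\<phi> x) = sweedler_sum s C (\<lambda>a b. tn D (\<phi> a) (\<phi> b)) x)}"

text \<open>
  The universal property ranges over all coalgebras in the ambient space. This is the full
  universal property as soon as the ambient space is infinite-dimensional: it then contains a copy
  of every finite-dimensional coalgebra, and every coalgebra is the union of its
  finite-dimensional subcoalgebras. If \<open>V\<close> is nonzero and the field infinite, the ambient space is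
  infinite-dimensional, because \<open>C\<close> contains the group-like elements over the points of \<open>V\<close>, which
  are linearly independent.
\<close>

definition is_cofree ::
  "('k::field \<Rightarrow> 'u::ab_group_add \<Rightarrow> 'u) \<Rightarrow> 'u set \<Rightarrow> ('k, 'u) coalgebra \<Rightarrow> ('u \<Rightarrow> 'u) \<Rightarrow> bool"
where
  "is_cofree s V C d \<longleftrightarrow>
     cocomm_coalgebra s C \<and> restrict d (car C) \<in> linmaps s s (car C) V \<and>
     (\<forall>D f. cocomm_coalgebra s D \<and> f \<in> linmaps s s (car D) V \<longrightarrow>
        (\<exists>!\<phi>. \<phi> \<in> coalg_morphisms s D C \<and> (\<forall>x\<in>car D. d (\<phi> x) = f x)))"

text \<open>The sum of \<open>f [x\<^sub>1\<^sub>(\<^sub>1\<^sub>), \<dots>, x\<^sub>n\<^sub>(\<^sub>1\<^sub>)] [x\<^sub>1\<^sub>(\<^sub>2\<^sub>), \<dots>, x\<^sub>n\<^sub>(\<^sub>2\<^sub>)]\<close>, i.e. \<open>f\<close> applied to the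
  comultiplication of the tensor product coalgebra \<open>C\<^sub>1 \<otimes> \<dots> \<otimes> C\<^sub>n\<close> at \<open>x\<^sub>1 \<otimes> \<dots> \<otimes> x\<^sub>n\<close>.\<close>

fun sweedler_sums ::
  "('k::field \<Rightarrow> 'u::ab_group_add \<Rightarrow> 'u) \<Rightarrow> ('k, 'u) coalgebra list \<Rightarrow> ('u list \<Rightarrow> 'u list \<Rightarrow> 'u) \<Rightarrow>
     'u list \<Rightarrow> 'u"
where
  "sweedler_sums s (C # Cs) f (x # xs) =
     sweedler_sum s C (\<lambda>a b. sweedler_sums s Cs (\<lambda>as bs. f (a # as) (b # bs)) xs) x"
| "sweedler_sums s _ f _ = f [] []"

text \<open>The unique coalgebra morphism \<open>C\<^sub>1 \<otimes> \<dots> \<otimes> C\<^sub>n \<rightarrow> D\<close> lifting \<open>f\<close> along \<open>d\<close>, with linear maps on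
  the tensor product written as multilinear maps.\<close>

definition coalg_lift ::
  "('k::field \<Rightarrow> 'u::ab_group_add \<Rightarrow> 'u) \<Rightarrow> ('k, 'u) coalgebra list \<Rightarrow> ('k, 'u) coalgebra \<Rightarrow>
     ('u \<Rightarrow> 'u) \<Rightarrow> ('u list \<Rightarrow> 'u) \<Rightarrow> 'u list \<Rightarrow> 'u"
where
  "coalg_lift s Cs D d f = (THE g.
     g \<in> extensional (listset (map car Cs)) \<and> multilinear_on s (map car Cs) (car D) g \<and>
     (\<forall>xs\<in>listset (map car Cs).
        d (g xs) = f xs \<and>
        counit D (g xs) = prod_list (map2 counit Cs xs) \<and>
        comul D (g xs) = sweedler_sums s Cs (\<lambda>as bs. tn D (g as) (g bs)) xs))"


section \<open>Formulas and their Sweedler semantics\<close>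

datatype 'p form =
    Atom 'p
  | Tensor "'p form" "'p form"
  | With "'p form" "'p form"
  | Lolli "'p form" "'p form"
  | Bang "'p form"

record ('p, 'k, 'u) semantics =
  sp :: "'p form \<Rightarrow> 'u set"
  tens :: "'p form \<Rightarrow> 'p form \<Rightarrow> 'u \<Rightarrow> 'u \<Rightarrow> 'u"
  proj1 :: "'p form \<Rightarrow> 'p form \<Rightarrow> 'u \<Rightarrow> 'u"
  proj2 :: "'p form \<Rightarrow> 'p form \<Rightarrow> 'u \<Rightarrow> 'u"
  app :: "'p form \<Rightarrow> 'p form \<Rightarrow> 'u \<Rightarrow> 'u \<Rightarrow> 'u"
  bang :: "'p form \<Rightarrow> ('k, 'u) coalgebra"
  der :: "'p form \<Rightarrow> 'u \<Rightarrow> 'u"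

text \<open>
  \<open>I\<close> is the Sweedler semantics on the subformulas of the given formula. Demanding it for all
  formulas at once would be wrong: it could fail to be satisfiable, since the dimensions of the
  spaces are in general not bounded by the cardinality of any type \<open>'u\<close>.
\<close>

primrec sweedler_semantics ::
  "('k::field \<Rightarrow> 'u::ab_group_add \<Rightarrow> 'u) \<Rightarrow> ('p, 'k, 'u) semantics \<Rightarrow> 'p form \<Rightarrow> bool"
where
  "sweedler_semantics s I (Atom p) \<longleftrightarrow> module.subspace s (sp I (Atom p))"
| "sweedler_semantics s I (Tensor A B) \<longleftrightarrow>
     sweedler_semantics s I A \<and> sweedler_semantics s I B \<and>
     is_tensor s (sp I A) (sp I B) (sp I (Tensor A B)) (tens I A B)"
| "sweedler_semantics s I (With A B) \<longleftrightarrow>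
     sweedler_semantics s I A \<and> sweedler_semantics s I B \<and>
     is_direct_sum s (sp I A) (sp I B) (sp I (With A B)) (proj1 I A B) (proj2 I A B)"
| "sweedler_semantics s I (Lolli A B) \<longleftrightarrow>
     sweedler_semantics s I A \<and> sweedler_semantics s I B \<and>
     is_hom_space s (sp I A) (sp I B) (sp I (Lolli A B)) (app I A B)"
| "sweedler_semantics s I (Bang A) \<longleftrightarrow>
     sweedler_semantics s I A \<and>
     sp I (Bang A) = car (bang I A) \<and> is_cofree s (sp I A) (bang I A) (der I A)"


section \<open>Proofs and their denotations\<close>

text \<open>
  Derivations of the sequent calculus, without their side conditions (see \<open>valid\<close>). Numbers are
  positions in the context, starting from \<open>0\<close>:
  \<^item> \<open>Exch\<close>: from \<open>\<Gamma>, A, B, \<Delta> \<turnstile> C\<close> infer \<open>\<Gamma>, B, A, \<Delta> \<turnstile> C\<close>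
  \<^item> \<open>Cut\<close>: from \<open>\<Gamma> \<turnstile> A\<close> and \<open>A, \<Delta> \<turnstile> C\<close> infer \<open>\<Gamma>, \<Delta> \<turnstile> C\<close>
  \<^item> \<open>TensorL\<close>: from \<open>\<Gamma>, A, B, \<Delta> \<turnstile> C\<close> infer \<open>\<Gamma>, A \<otimes> B, \<Delta> \<turnstile> C\<close>
  \<^item> \<open>TensorR\<close>: from \<open>\<Gamma> \<turnstile> A\<close> and \<open>\<Delta> \<turnstile> B\<close> infer \<open>\<Gamma>, \<Delta> \<turnstile> A \<otimes> B\<close>
  \<^item> \<open>WithL1\<close>, \<open>WithL2\<close>: from \<open>\<Gamma>, A, \<Delta> \<turnstile> C\<close> or \<open>\<Gamma>, B, \<Delta> \<turnstile> C\<close> infer \<open>\<Gamma>, A & B, \<Delta> \<turnstile> C\<close>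
  \<^item> \<open>WithR\<close>: from \<open>\<Gamma> \<turnstile> A\<close> and \<open>\<Gamma> \<turnstile> B\<close> infer \<open>\<Gamma> \<turnstile> A & B\<close>
  \<^item> \<open>LolliL\<close>: from \<open>\<Gamma> \<turnstile> A\<close> and \<open>B, \<Delta> \<turnstile> C\<close> infer \<open>A \<multimap> B, \<Gamma>, \<Delta> \<turnstile> C\<close>
  \<^item> \<open>LolliR\<close>: from \<open>\<Gamma>, A \<turnstile> B\<close> infer \<open>\<Gamma> \<turnstile> A \<multimap> B\<close>
  \<^item> \<open>Der\<close>: from \<open>\<Gamma>, A, \<Delta> \<turnstile> C\<close> infer \<open>\<Gamma>, !A, \<Delta> \<turnstile> C\<close>
  \<^item> \<open>Weak\<close>: from \<open>\<Gamma>, \<Delta> \<turnstile> C\<close> infer \<open>\<Gamma>, !A, \<Delta> \<turnstile> C\<close>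
  \<^item> \<open>Ctr\<close>: from \<open>\<Gamma>, !A, !A, \<Delta> \<turnstile> C\<close> infer \<open>\<Gamma>, !A, \<Delta> \<turnstile> C\<close>
  \<^item> \<open>Prom\<close>: from \<open>!A\<^sub>1, \<dots>, !A\<^sub>n \<turnstile> B\<close> infer \<open>!A\<^sub>1, \<dots>, !A\<^sub>n \<turnstile> !B\<close>
\<close>

datatype 'p deriv =
    Ax "'p form"
  | Exch nat "'p deriv"
  | Cut "'p deriv" "'p deriv"
  | TensorL nat "'p deriv"
  | TensorR "'p deriv" "'p deriv"
  | WithL1 nat "'p form" "'p deriv"
  | WithL2 nat "'p form" "'p deriv"
  | WithR "'p deriv" "'p deriv"
  | LolliL "'p deriv" "'p deriv"
  | LolliR "'p deriv"
  | Der nat "'p deriv"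
  | Weak nat "'p form" "'p deriv"
  | Ctr nat "'p form" "'p deriv"
  | Prom "'p form list" "'p deriv"

definition exchange :: "nat \<Rightarrow> 'a list \<Rightarrow> 'a list" where
  "exchange i xs = xs[i := xs ! Suc i, Suc i := xs ! i]"

text \<open>Replace the entry at position \<open>i\<close> by the entries \<open>ys\<close>.\<close>

definition splice_at :: "nat \<Rightarrow> 'a list \<Rightarrow> 'a list \<Rightarrow> 'a list" where
  "splice_at i ys xs = take i xs @ ys @ drop (Suc i) xs"

primrec seq :: "'p deriv \<Rightarrow> 'p form list \<times> 'p form" where
  "seq (Ax A) = ([A], A)"
| "seq (Exch i \<pi>) = (exchange i (fst (seq \<pi>)), snd (seq \<pi>))"
| "seq (Cut \<pi> \<rho>) = (fst (seq \<pi>) @ tl (fst (seq \<rho>)), snd (seq \<rho>))"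
| "seq (TensorL i \<pi>) = (let \<Gamma> = fst (seq \<pi>) in
     (take i \<Gamma> @ [Tensor (\<Gamma> ! i) (\<Gamma> ! Suc i)] @ drop (i + 2) \<Gamma>, snd (seq \<pi>)))"
| "seq (TensorR \<pi> \<rho>) = (fst (seq \<pi>) @ fst (seq \<rho>), Tensor (snd (seq \<pi>)) (snd (seq \<rho>)))"
| "seq (WithL1 i B \<pi>) = ((fst (seq \<pi>))[i := With (fst (seq \<pi>) ! i) B], snd (seq \<pi>))"
| "seq (WithL2 i A \<pi>) = ((fst (seq \<pi>))[i := With A (fst (seq \<pi>) ! i)], snd (seq \<pi>))"
| "seq (WithR \<pi> \<rho>) = (fst (seq \<pi>), With (snd (seq \<pi>)) (snd (seq \<rho>)))"
| "seq (LolliL \<pi> \<rho>) =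
     (Lolli (snd (seq \<pi>)) (hd (fst (seq \<rho>))) # fst (seq \<pi>) @ tl (fst (seq \<rho>)), snd (seq \<rho>))"
| "seq (LolliR \<pi>) = (butlast (fst (seq \<pi>)), Lolli (last (fst (seq \<pi>))) (snd (seq \<pi>)))"
| "seq (Der i \<pi>) = ((fst (seq \<pi>))[i := Bang (fst (seq \<pi>) ! i)], snd (seq \<pi>))"
| "seq (Weak i A \<pi>) = (take i (fst (seq \<pi>)) @ [Bang A] @ drop i (fst (seq \<pi>)), snd (seq \<pi>))"
| "seq (Ctr i A \<pi>) = (take i (fst (seq \<pi>)) @ [Bang A] @ drop (i + 2) (fst (seq \<pi>)), snd (seq \<pi>))"
| "seq (Prom As \<pi>) = (map Bang As, Bang (snd (seq \<pi>)))"

abbreviation ctx :: "'p deriv \<Rightarrow> 'p form list" where "ctx \<pi> \<equiv> fst (seq \<pi>)"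
abbreviation concl :: "'p deriv \<Rightarrow> 'p form" where "concl \<pi> \<equiv> snd (seq \<pi>)"

primrec valid :: "'p deriv \<Rightarrow> bool" where
  "valid (Ax A) \<longleftrightarrow> True"
| "valid (Exch i \<pi>) \<longleftrightarrow> valid \<pi> \<and> Suc i < length (ctx \<pi>)"
| "valid (Cut \<pi> \<rho>) \<longleftrightarrow> valid \<pi> \<and> valid \<rho> \<and> ctx \<rho> \<noteq> [] \<and> hd (ctx \<rho>) = concl \<pi>"
| "valid (TensorL i \<pi>) \<longleftrightarrow> valid \<pi> \<and> Suc i < length (ctx \<pi>)"
| "valid (TensorR \<pi> \<rho>) \<longleftrightarrow> valid \<pi> \<and> valid \<rho>"
| "valid (WithL1 i B \<pi>) \<longleftrightarrow> valid \<pi> \<and> i < length (ctx \<pi>)"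
| "valid (WithL2 i A \<pi>) \<longleftrightarrow> valid \<pi> \<and> i < length (ctx \<pi>)"
| "valid (WithR \<pi> \<rho>) \<longleftrightarrow> valid \<pi> \<and> valid \<rho> \<and> ctx \<pi> = ctx \<rho>"
| "valid (LolliL \<pi> \<rho>) \<longleftrightarrow> valid \<pi> \<and> valid \<rho> \<and> ctx \<rho> \<noteq> []"
| "valid (LolliR \<pi>) \<longleftrightarrow> valid \<pi> \<and> ctx \<pi> \<noteq> []"
| "valid (Der i \<pi>) \<longleftrightarrow> valid \<pi> \<and> i < length (ctx \<pi>)"
| "valid (Weak i A \<pi>) \<longleftrightarrow> valid \<pi> \<and> i \<le> length (ctx \<pi>)"
| "valid (Ctr i A \<pi>) \<longleftrightarrow> valid \<pi> \<and> Suc i < length (ctx \<pi>) \<and>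
     ctx \<pi> ! i = Bang A \<and> ctx \<pi> ! Suc i = Bang A"
| "valid (Prom As \<pi>) \<longleftrightarrow> valid \<pi> \<and> ctx \<pi> = map Bang As"

text \<open>
  The linear map from the tensor product of the spaces of \<open>A\<^sub>1, \<dots>, A\<^sub>n\<close> to the space of \<open>B\<close> denoted
  by a proof of \<open>A\<^sub>1, \<dots>, A\<^sub>n \<turnstile> B\<close> is given as the multilinear map sending \<open>[x\<^sub>1, \<dots>, x\<^sub>n]\<close> to its value
  at \<open>x\<^sub>1 \<otimes> \<dots> \<otimes> x\<^sub>n\<close>. For \<open>n = 0\<close> the value at \<open>[]\<close> is the element denoted by a proof of \<open>\<turnstile> B\<close>.
\<close>

primrec den ::
  "('k::field \<Rightarrow> 'u::ab_group_add \<Rightarrow> 'u) \<Rightarrow> ('p, 'k, 'u) semantics \<Rightarrow> 'p deriv \<Rightarrow> 'u list \<Rightarrow> 'u"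
where
  "den s I (Ax A) = (\<lambda>xs. hd xs)"
| "den s I (Exch i \<pi>) = (\<lambda>xs. den s I \<pi> (exchange i xs))"
| "den s I (Cut \<pi> \<rho>) = (\<lambda>xs. let n = length (ctx \<pi>) in
     den s I \<rho> (den s I \<pi> (take n xs) # drop n xs))"
| "den s I (TensorL i \<pi>) = (\<lambda>xs. let A = ctx \<pi> ! i; B = ctx \<pi> ! Suc i in
     tensor_lift s (sp I A) (sp I B) (sp I (Tensor A B)) (tens I A B)
       (\<lambda>a b. den s I \<pi> (splice_at i [a, b] xs)) (xs ! i))"
| "den s I (TensorR \<pi> \<rho>) = (\<lambda>xs. let n = length (ctx \<pi>) in
     tens I (concl \<pi>) (concl \<rho>) (den s I \<pi> (take n xs)) (den s I \<rho> (drop n xs)))"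
| "den s I (WithL1 i B \<pi>) = (\<lambda>xs. den s I \<pi> (xs[i := proj1 I (ctx \<pi> ! i) B (xs ! i)]))"
| "den s I (WithL2 i A \<pi>) = (\<lambda>xs. den s I \<pi> (xs[i := proj2 I A (ctx \<pi> ! i) (xs ! i)]))"
| "den s I (WithR \<pi> \<rho>) = (\<lambda>xs. let A = concl \<pi>; B = concl \<rho> in
     inv_into (sp I (With A B)) (\<lambda>x. (proj1 I A B x, proj2 I A B x)) (den s I \<pi> xs, den s I \<rho> xs))"
| "den s I (LolliL \<pi> \<rho>) = (\<lambda>xs. let n = length (ctx \<pi>) in
     den s I \<rho> (app I (concl \<pi>) (hd (ctx \<rho>)) (hd xs) (den s I \<pi> (take n (tl xs))) # drop n (tl xs)))"
| "den s I (LolliR \<pi>) = (\<lambda>xs. let A = last (ctx \<pi>); B = concl \<pi> in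
     inv_into (sp I (Lolli A B)) (app I A B) (\<lambda>a\<in>sp I A. den s I \<pi> (xs @ [a])))"
| "den s I (Der i \<pi>) = (\<lambda>xs. den s I \<pi> (xs[i := der I (ctx \<pi> ! i) (xs ! i)]))"
| "den s I (Weak i A \<pi>) = (\<lambda>xs. s (counit (bang I A) (xs ! i)) (den s I \<pi> (splice_at i [] xs)))"
| "den s I (Ctr i A \<pi>) = (\<lambda>xs.
     sweedler_sum s (bang I A) (\<lambda>a b. den s I \<pi> (splice_at i [a, b] xs)) (xs ! i))"
| "den s I (Prom As \<pi>) = (\<lambda>xs.
     coalg_lift s (map (bang I) As) (bang I (concl \<pi>)) (der I (concl \<pi>)) (den s I \<pi>) xs)"


section \<open>Binary integers\<close>

definition bint :: "'p form \<Rightarrow> 'p form" where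
  "bint A = Lolli (Bang (Lolli A A)) (Lolli (Bang (Lolli A A)) (Lolli A A))"

text \<open>Move the formula at position \<open>i\<close> to the right, past \<open>m\<close> others.\<close>

fun move_right :: "nat \<Rightarrow> nat \<Rightarrow> 'p deriv \<Rightarrow> 'p deriv" where
  "move_right i 0 \<pi> = \<pi>"
| "move_right i (Suc m) \<pi> = move_right (Suc i) m (Exch i \<pi>)"

text \<open>Turn the \<open>m\<close> copies of \<open>!B\<close> from position \<open>i\<close> on into a single one.\<close>

fun contract :: "nat \<Rightarrow> 'p form \<Rightarrow> nat \<Rightarrow> 'p deriv \<Rightarrow> 'p deriv" where
  "contract i B 0 \<pi> = Weak i B \<pi>"
| "contract i B (Suc 0) \<pi> = \<pi>"
| "contract i B (Suc (Suc m)) \<pi> = contract i B (Suc m) (Ctr i B \<pi>)"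

text \<open>
  Digits are booleans, \<open>False\<close> for \<open>0\<close> and \<open>True\<close> for \<open>1\<close>. For a sequence \<open>s\<^sub>l, \<dots>, s\<^sub>1\<close> (listed
  from the outermost occurrence inwards), \<open>occurrences\<close> is the proof of \<open>!E, \<dots>, !E, A \<turnstile> A\<close> given by
  \<open>u\<^sub>s\<^sub>l (\<dots> (u\<^sub>s\<^sub>1 a))\<close>, with one hypothesis \<open>!E\<close> per occurrence, those for \<open>u\<^sub>0\<close> preceding those
  for \<open>u\<^sub>1\<close>.
\<close>

fun occurrences :: "'p form \<Rightarrow> bool list \<Rightarrow> 'p deriv" where
  "occurrences A [] = Ax A"
| "occurrences A (b # S) =
     (let \<pi> = Der 0 (LolliL (occurrences A S) (Ax A))
      in if b then move_right 0 (count_list S False) \<pi> else \<pi>)"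

text \<open>The three uses of \<open>LolliR\<close> bind \<open>a\<close>, \<open>u\<^sub>1\<close> and \<open>u\<^sub>0\<close>, in this order.\<close>

definition binary_integer :: "'p form \<Rightarrow> bool list \<Rightarrow> 'p deriv" where
  "binary_integer A S =
     LolliR (LolliR (LolliR
       (contract 1 (Lolli A A) (count_list S True)
         (contract 0 (Lolli A A) (count_list S False)
           (occurrences A (rev S))))))"

lemma seq_move_right:
  assumes "valid \<pi>" "ctx \<pi> = xs @ replicate (Suc m) B @ ys" "i = length xs"
  shows "valid (move_right i m \<pi>) \<and> seq (move_right i m \<pi>) = seq \<pi>"
  using assms
proof (induction m arbitrary: i xs \<pi>)
  case (Suc m)
  have ex: "exchange i (ctx \<pi>) = ctx \<pi>"
    using Suc.prems by (simp add: exchange_def nth_append list_update_append)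
  have "valid (Exch i \<pi>)" using Suc.prems by simp
  moreover have "ctx (Exch i \<pi>) = (xs @ [B]) @ replicate (Suc m) B @ ys"
    using Suc.prems ex by simp
  ultimately show ?case
    using Suc.IH[of "Exch i \<pi>" "xs @ [B]" "Suc i"] Suc.prems ex by (simp add: prod_eq_iff)
qed simp

lemma seq_contract:
  assumes "valid \<pi>" "ctx \<pi> = xs @ replicate m (Bang B) @ ys" "i = length xs"
  shows "valid (contract i B m \<pi>) \<and> seq (contract i B m \<pi>) = (xs @ Bang B # ys, concl \<pi>)"
  using assms
proof (induction i B m \<pi> rule: contract.induct)
  case (3 i B m \<pi>)
  have "valid (Ctr i B \<pi>)" using 3(2-4) by (simp add: nth_append)
  moreover have "ctx (Ctr i B \<pi>) = xs @ replicate (Suc m) (Bang B) @ ys" using 3(2-4) by simp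
  ultimately show ?case using 3(1) 3(4) by simp
qed (auto simp: prod_eq_iff)

lemma seq_occurrences:
  "valid (occurrences A S) \<and>
   seq (occurrences A S) =
     (replicate (count_list S False) (Bang (Lolli A A)) @
      replicate (count_list S True) (Bang (Lolli A A)) @ [A], A)"
proof (induction S)
  case (Cons b S)
  let ?E = "Bang (Lolli A A)"
  let ?\<pi> = "Der 0 (LolliL (occurrences A S) (Ax A))"
  have 1: "valid ?\<pi>" using Cons by simp
  have 2: "seq ?\<pi> = (?E # replicate (count_list S False) ?E @
      replicate (count_list S True) ?E @ [A], A)"
    using Cons by simp
  show ?case
  proof (cases b)
    case True
    have "ctx ?\<pi> = [] @ replicate (Suc (count_list S False)) ?E @
      (replicate (count_list S True) ?E @ [A])" using 2 by simp
    from seq_move_right[OF 1 this] show ?thesis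
      using True 2 by (simp add: Let_def replicate_app_Cons_same)
  next
    case False
    then show ?thesis using 1 2 by (simp add: Let_def)
  qed
qed simp

theorem binary_integer_proves_bint:
  "valid (binary_integer A S) \<and> seq (binary_integer A S) = ([], bint A)"
proof -
  let ?B = "Lolli A A"
  have cr: "count_list (rev S) b = count_list S b" for b
    by (induction S) auto
  note o = seq_occurrences[of A "rev S", unfolded cr]
  define \<pi> where "\<pi> = contract 0 ?B (count_list S False) (occurrences A (rev S))"
  have p: "valid \<pi> \<and> seq \<pi> = (Bang ?B # replicate (count_list S True) (Bang ?B) @ [A], A)"
    unfolding \<pi>_def
    using seq_contract[of "occurrences A (rev S)" "[]" "count_list S False" ?B
        "replicate (count_list S True) (Bang ?B) @ [A]" 0] o by simp
  have "valid (contract 1 ?B (count_list S True) \<pi>) \<and>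
      seq (contract 1 ?B (count_list S True) \<pi>) = ([Bang ?B, Bang ?B, A], A)"
    using seq_contract[of \<pi> "[Bang ?B]" "count_list S True" ?B "[A]" 1] p by simp
  then show ?thesis
    unfolding binary_integer_def bint_def \<pi>_def by simp
qed

end

theory Submission
  imports Defs
begin

text \<open>
  A group-like element over any endomorphism \<open>P\<close> is obtained by applying the universal property of
  \<open>!\<close> to the one-dimensional coalgebra spanned by a group-like element \<open>g\<close> and to the linear map
  \<open>g \<mapsto> P\<close>. On group-like elements contraction duplicates its argument, so there the denotation of
  the binary integer \<open>S\<close> is a composite of endomorphisms \<open>\<alpha> False\<close>, \<open>\<alpha> True\<close> prescribed by \<open>S\<close>.
  For independent \<open>e1\<close>, \<open>e2\<close> let \<open>\<alpha> b\<close> send \<open>x e1 + y e2\<close> to \<open>(2 x + (1 + b) y) e1 + y e2\<close>. The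
  composite then sends \<open>e2\<close> to \<open>n e1 + e2\<close>, where \<open>n\<close> has the digits \<open>1 + b\<close> in bijective base 2. Such
  numerals are unique, leading digits included, and \<open>n\<close> can be read off in characteristic zero.
\<close>

section \<open>Lists of arguments and changes at one position\<close>

lemma in_listset_iff: "xs \<in> listset Vs \<longleftrightarrow> list_all2 (\<in>) xs Vs"
  by (induction Vs arbitrary: xs) (auto simp: set_Cons_def list_all2_Cons2)

lemma exchange_append:
  "i = length as \<Longrightarrow> exchange i (as @ x # y # bs) = as @ y # x # bs"
  by (simp add: exchange_def nth_append list_update_append)

lemma splice_at_append:
  "i = length as \<Longrightarrow> splice_at i ys (as @ x # bs) = as @ ys @ bs"
  by (simp add: splice_at_def)

section \<open>Coalgebra structure on a line\<close>

definition line_coord :: "('k::field \<Rightarrow> 'u::ab_group_add \<Rightarrow> 'u) \<Rightarrow> 'u \<Rightarrow> 'u \<Rightarrow> 'k" where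
  "line_coord s g v = module.representation s {g} v g"

text \<open>The tensor square of a line is again a line, so the same line is reused for it, with g
  \<otimes> g identified with g. Under this identification the comultiplication that makes g
  group-like is the identity.\<close>

definition line_coalgebra :: "('k::field \<Rightarrow> 'u::ab_group_add \<Rightarrow> 'u) \<Rightarrow> 'u \<Rightarrow> ('k, 'u) coalgebra" where
  "line_coalgebra s g = \<lparr>car = module.span s {g}, sq = module.span s {g},
     tn = \<lambda>v w. s (line_coord s g v) w, comul = \<lambda>v. v, counit = line_coord s g\<rparr>"

lemma line_coalgebra_simps [simp]:
  "car (line_coalgebra s g) = module.span s {g}" "sq (line_coalgebra s g) = module.span s {g}"
  "tn (line_coalgebra s g) v w = s (line_coord s g v) w"
  "comul (line_coalgebra s g) v = v" "counit (line_coalgebra s g) = line_coord s g"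
  by (simp_all add: line_coalgebra_def)

section \<open>Bijective base 2 numerals, least significant digit first\<close>

fun bijective_binary :: "bool list \<Rightarrow> nat" where
  "bijective_binary [] = 0"
| "bijective_binary (b # S) = 2 * bijective_binary S + (if b then 2 else 1)"

text \<open>As the digits are 1 and 2, only the empty numeral has value 0, and parity determines the
  first digit of a nonempty one. Removing that digit leaves equal values again.\<close>

lemma inj_bijective_binary: "inj bijective_binary"
proof (rule injI)
  fix S T assume "bijective_binary S = bijective_binary T"
  then show "S = T"
  proof (induction S arbitrary: T)
    case Nil
    then show ?case by (cases T) (auto split: if_splits)
  next
    case (Cons b S)
    then obtain c T' where T: "T = c # T'" by (cases T) (auto split: if_splits)
    then have "b = c \<and> bijective_binary S = bijective_binary T'"
      using Cons.prems by (simp split: if_splits) presburger+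
    then show ?case using Cons.IH T by simp
  qed
qed

context vector_space
begin

section \<open>Linear and multilinear maps\<close>

lemma restrict_in_linmaps_iff:
  assumes "subspace V"
  shows "restrict f V \<in> linmaps scale t V W \<longleftrightarrow>
    (\<forall>x\<in>V. f x \<in> W) \<and> (\<forall>x\<in>V. \<forall>y\<in>V. f (x + y) = f x + f y) \<and> (\<forall>c. \<forall>x\<in>V. f (c *s x) = t c (f x))"
  using assms by (auto simp: linmaps_def subspace_add subspace_scale PiE_iff)

lemma linmapsD:
  assumes "f \<in> linmaps scale t V W"
  shows "x \<in> V \<Longrightarrow> f x \<in> W" "x \<in> V \<Longrightarrow> y \<in> V \<Longrightarrow> f (x + y) = f x + f y"
    "x \<in> V \<Longrightarrow> f (c *s x) = t c (f x)"
  using assms by (auto simp: linmaps_def)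

lemma linmaps_eqI:
  assumes "f \<in> linmaps scale t V W" "g \<in> linmaps scale t V W'" "\<And>x. x \<in> V \<Longrightarrow> f x = g x"
  shows "f = g"
  using assms unfolding linmaps_def by (metis (no_types, lifting) PiE_ext mem_Collect_eq extensionalityI PiE_iff)

lemma bilinear_on_iff:
  assumes "subspace V" "subspace W"
  shows "bilinear_on scale V W X \<beta> \<longleftrightarrow>
    (\<forall>v\<in>V. \<forall>w\<in>W. \<beta> v w \<in> X) \<and>
    (\<forall>v\<in>V. \<forall>w\<in>W. \<forall>w'\<in>W. \<beta> v (w + w') = \<beta> v w + \<beta> v w') \<and>
    (\<forall>v\<in>V. \<forall>w\<in>W. \<forall>c. \<beta> v (c *s w) = c *s \<beta> v w) \<and>
    (\<forall>v\<in>V. \<forall>v'\<in>V. \<forall>w\<in>W. \<beta> (v + v') w = \<beta> v w + \<beta> v' w) \<and>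
    (\<forall>v\<in>V. \<forall>w\<in>W. \<forall>c. \<beta> (c *s v) w = c *s \<beta> v w)"
  unfolding bilinear_on_def using assms by (auto simp: restrict_in_linmaps_iff)

text \<open>Splitting the list of spaces as \<open>As @ V # Bs\<close> replaces the index of the
  varying slot. Argument lists of derivations are built with append, and in this form no list
  updates remain.\<close>

lemma multilinear_on_iff:
  assumes "\<forall>V\<in>set Vs. subspace V"
  shows "multilinear_on scale Vs W g \<longleftrightarrow>
    (\<forall>xs. list_all2 (\<in>) xs Vs \<longrightarrow> g xs \<in> W) \<and>
    (\<forall>As V Bs as bs. Vs = As @ V # Bs \<longrightarrow> list_all2 (\<in>) as As \<longrightarrow> list_all2 (\<in>) bs Bs \<longrightarrow>
      (\<lambda>x\<in>V. g (as @ x # bs)) \<in> linmaps scale scale V W)"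
    (is "_ \<longleftrightarrow> ?val \<and> ?split")
proof
  assume ml: "multilinear_on scale Vs W g"
  have "(\<lambda>x\<in>V. g (as @ x # bs)) \<in> linmaps scale scale V W"
    if "Vs = As @ V # Bs" "list_all2 (\<in>) as As" "list_all2 (\<in>) bs Bs" for As V Bs as bs
  proof -
    \<comment> \<open>The definition asks for a full argument list, whose entry at the varying slot
      is then overwritten; 0 is an element that every subspace offers.\<close>
    have "as @ 0 # bs \<in> listset Vs"
      using that assms by (auto simp: in_listset_iff subspace_0 intro!: list_all2_appendI)
    moreover have l: "length as = length As"
      using that list_all2_lengthD by blast
    moreover have "length as < length Vs"
      using that l by simp
    ultimately have "(\<lambda>x\<in>Vs ! length as. g ((as @ 0 # bs)[length as := x]))
        \<in> linmaps scale scale (Vs ! length as) W"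
      using ml unfolding multilinear_on_def by blast
    moreover have "Vs ! length as = V"
      using that l by simp
    ultimately show ?thesis
      by simp
  qed
  then show "?val \<and> ?split"
    using ml by (auto simp: multilinear_on_def in_listset_iff)
next
  assume *: "?val \<and> ?split"
  have "(\<lambda>x\<in>Vs ! i. g (xs[i := x])) \<in> linmaps scale scale (Vs ! i) W"
    if xs: "list_all2 (\<in>) xs Vs" and i: "i < length Vs" for xs i
  proof -
    have "Vs = take i Vs @ Vs ! i # drop (Suc i) Vs"
      using i by (simp add: id_take_nth_drop)
    moreover have "i < length xs"
      using xs i list_all2_lengthD by fastforce
    ultimately show ?thesis
      using * xs by (simp add: upd_conv_take_nth_drop list_all2_takeI list_all2_dropI)
  qed
  then show "multilinear_on scale Vs W g"
    using * by (auto simp: multilinear_on_def in_listset_iff)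
qed

lemma multilinear_on_value:
  "multilinear_on scale Vs W g \<Longrightarrow> list_all2 (\<in>) xs Vs \<Longrightarrow> g xs \<in> W"
  by (auto simp: multilinear_on_def in_listset_iff)

lemma multilinear_on_linmaps:
  assumes "multilinear_on scale Vs W g" "\<forall>V\<in>set Vs. subspace V"
    "Vs = As @ V # Bs" "list_all2 (\<in>) as As" "list_all2 (\<in>) bs Bs"
  shows "(\<lambda>x\<in>V. g (as @ x # bs)) \<in> linmaps scale scale V W"
  using assms multilinear_on_iff by blast

text \<open>For operations acting at the slot of V, such as exchange, contraction and weakening: a
  splitting of the list selects a slot to the left of V, V itself, or a slot to its right.\<close>

lemma multilinear_on_middleI:
  assumes sub: "\<forall>U\<in>set (As @ V # Bs). subspace U"
    and val: "\<And>as x bs. list_all2 (\<in>) as As \<Longrightarrow> x \<in> V \<Longrightarrow> list_all2 (\<in>) bs Bs \<Longrightarrow>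
      g (as @ x # bs) \<in> W"
    and left: "\<And>A1 U A2 a1 a2 x bs. As = A1 @ U # A2 \<Longrightarrow> list_all2 (\<in>) a1 A1 \<Longrightarrow>
      list_all2 (\<in>) a2 A2 \<Longrightarrow> x \<in> V \<Longrightarrow> list_all2 (\<in>) bs Bs \<Longrightarrow>
      (\<lambda>u\<in>U. g (a1 @ u # a2 @ x # bs)) \<in> linmaps scale scale U W"
    and mid: "\<And>as bs. list_all2 (\<in>) as As \<Longrightarrow> list_all2 (\<in>) bs Bs \<Longrightarrow>
      (\<lambda>x\<in>V. g (as @ x # bs)) \<in> linmaps scale scale V W"
    and right: "\<And>B1 U B2 as x b1 b2. Bs = B1 @ U # B2 \<Longrightarrow> list_all2 (\<in>) as As \<Longrightarrow> x \<in> V \<Longrightarrow>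
      list_all2 (\<in>) b1 B1 \<Longrightarrow> list_all2 (\<in>) b2 B2 \<Longrightarrow>
      (\<lambda>u\<in>U. g (as @ x # b1 @ u # b2)) \<in> linmaps scale scale U W"
  shows "multilinear_on scale (As @ V # Bs) W g"
proof -
  have "(\<lambda>u\<in>U. g (xs @ u # ys)) \<in> linmaps scale scale U W"
    if eq: "As @ V # Bs = Xs @ U # Ys" and xs: "list_all2 (\<in>) xs Xs" and ys: "list_all2 (\<in>) ys Ys"
    for Xs U Ys xs ys
  proof -
    consider (left) A2 where "As = Xs @ U # A2" "Ys = A2 @ V # Bs"
      | (mid) "Xs = As" "U = V" "Ys = Bs"
      | (right) B1 where "Xs = As @ V # B1" "Bs = B1 @ U # Ys"
      using eq by (auto simp: append_eq_append_conv2 append_eq_Cons_conv Cons_eq_append_conv)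
    then show ?thesis
    proof cases
      case left
      then obtain a2 x bs where "ys = a2 @ x # bs" "list_all2 (\<in>) a2 A2" "x \<in> V"
          "list_all2 (\<in>) bs Bs"
        using ys by (auto simp: list_all2_append2 list_all2_Cons2)
      then show ?thesis
        using assms(3)[OF left(1) xs] by simp
    next
      case mid
      then show ?thesis using assms(4) xs ys by simp
    next
      case right
      then obtain as x b1 where "xs = as @ x # b1" "list_all2 (\<in>) as As" "x \<in> V"
          "list_all2 (\<in>) b1 B1"
        using xs by (auto simp: list_all2_append2 list_all2_Cons2)
      then show ?thesis
        using assms(5)[OF right(2)] ys by simp
    qed
  qed
  moreover have "g xs \<in> W" if "list_all2 (\<in>) xs (As @ V # Bs)" for xs
    using that val by (auto simp: list_all2_append2 list_all2_Cons2)
  ultimately show ?thesis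
    using multilinear_on_iff[OF sub] by blast
qed

text \<open>Swapping two adjacent arguments only moves slots around: each slot of the swapped list
  is a slot of the original list, in which g is linear already.\<close>

lemma multilinear_on_exchange:
  assumes g: "multilinear_on scale (As @ V # U # Bs) W g"
    and sub: "\<forall>X\<in>set (As @ V # U # Bs). subspace X"
  shows "multilinear_on scale (As @ U # V # Bs) W (\<lambda>xs. g (exchange (length As) xs))"
proof (rule multilinear_on_middleI)
  note lin = multilinear_on_linmaps[OF g sub]
  show "\<forall>X\<in>set (As @ U # V # Bs). subspace X" using sub by auto
  fix as assume as: "list_all2 (\<in>) as As"
  then have len: "length As = length as" by (simp add: list_all2_lengthD)
  {
    fix x bs assume x: "x \<in> U" and bs: "list_all2 (\<in>) bs (V # Bs)"
    then show "g (exchange (length As) (as @ x # bs)) \<in> W"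
      using as len
      by (auto simp: exchange_append list_all2_Cons2
          intro!: multilinear_on_value[OF g] list_all2_appendI)
  next
    fix bs assume bs: "list_all2 (\<in>) bs (V # Bs)"
    then obtain v bs' where bs': "bs = v # bs'" "v \<in> V" "list_all2 (\<in>) bs' Bs"
      by (auto simp: list_all2_Cons2)
    then show "(\<lambda>x\<in>U. g (exchange (length As) (as @ x # bs))) \<in> linmaps scale scale U W"
      using lin[of "As @ [V]" U Bs "as @ [v]" bs'] as len
      by (simp add: exchange_append list_all2_appendI)
  next
    fix B1 X B2 x b1 b2
    assume eq: "V # Bs = B1 @ X # B2" and x: "x \<in> U"
      and b1: "list_all2 (\<in>) b1 B1" and b2: "list_all2 (\<in>) b2 B2"
    show "(\<lambda>u\<in>X. g (exchange (length As) (as @ x # b1 @ u # b2))) \<in> linmaps scale scale X W"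
    \<comment> \<open>With \<open>B1\<close> empty the varying slot is V, the second one here but
      the first of the two after the exchange.\<close>
    proof (cases B1)
      case Nil
      then show ?thesis
        using lin[of As V "U # Bs" as "x # b2"] eq x b1 b2 as len by (simp add: exchange_append)
    next
      case (Cons V' B1')
      then obtain v b1' where "b1 = v # b1'" "v \<in> V" "list_all2 (\<in>) b1' B1'" "Bs = B1' @ X # B2"
        using b1 eq by (auto simp: list_all2_Cons2)
      then show ?thesis
        using lin[of "As @ V # U # B1'" X B2 "as @ v # x # b1'" b2] x b2 as len
        by (simp add: exchange_append list_all2_appendI)
    qed
  }
next
  note lin = multilinear_on_linmaps[OF g sub]
  fix A1 X A2 a1 a2 x bs
  assume A: "As = A1 @ X # A2" and a1: "list_all2 (\<in>) a1 A1" and a2: "list_all2 (\<in>) a2 A2"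
    and x: "x \<in> U" and bs: "list_all2 (\<in>) bs (V # Bs)"
  then obtain v bs' where bs': "bs = v # bs'" "v \<in> V" "list_all2 (\<in>) bs' Bs"
    by (auto simp: list_all2_Cons2)
  have ex: "exchange (length As) (a1 @ u # a2 @ x # bs) = a1 @ u # a2 @ v # x # bs'" for u
    using exchange_append[of "length As" "a1 @ u # a2" x v bs'] A a1 a2 bs'
    by (simp add: list_all2_lengthD)
  show "(\<lambda>u\<in>X. g (exchange (length As) (a1 @ u # a2 @ x # bs))) \<in> linmaps scale scale X W"
    unfolding ex
    using lin[of A1 X "A2 @ V # U # Bs" a1 "a2 @ v # x # bs'"] A a1 a2 x bs'
    by (simp add: list_all2_appendI)
qed

section \<open>Sweedler sums\<close>

text \<open>\<open>tensor_lift\<close> is characterized among maps into the whole ambient space,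
  while its values are wanted in X. The universal property for X yields a map that also qualifies
  for the ambient space, where uniqueness identifies it with the lift.\<close>

lemma
  assumes T: "is_tensor scale V W T \<tau>" and \<beta>: "bilinear_on scale V W X \<beta>" and X: "subspace X"
    and sub: "subspace V" "subspace W"
  shows tensor_lift_in_linmaps: "tensor_lift scale V W T \<tau> \<beta> \<in> linmaps scale scale T X"
    and tensor_lift_tensor: "v \<in> V \<Longrightarrow> w \<in> W \<Longrightarrow> tensor_lift scale V W T \<tau> \<beta> (\<tau> v w) = \<beta> v w"
    and tensor_lift_unique: "f \<in> linmaps scale scale T UNIV \<Longrightarrow>
      (\<And>v w. v \<in> V \<Longrightarrow> w \<in> W \<Longrightarrow> f (\<tau> v w) = \<beta> v w) \<Longrightarrow> f = tensor_lift scale V W T \<tau> \<beta>"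
proof -
  let ?P = "\<lambda>X g. g \<in> linmaps scale scale T X \<and> (\<forall>v\<in>V. \<forall>w\<in>W. g (\<tau> v w) = \<beta> v w)"
  have "bilinear_on scale V W UNIV \<beta>"
    using \<beta> sub by (auto simp: bilinear_on_iff)
  then have ex1: "\<exists>!g. ?P UNIV g"
    using T subspace_UNIV unfolding is_tensor_def by blast
  obtain g where g: "?P X g"
    using T \<beta> X unfolding is_tensor_def by blast
  then have "?P UNIV g"
    unfolding linmaps_def by auto
  with ex1 have lift: "tensor_lift scale V W T \<tau> \<beta> = g"
    unfolding tensor_lift_def by (intro the1_equality)
  show "tensor_lift scale V W T \<tau> \<beta> \<in> linmaps scale scale T X"
    and "v \<in> V \<Longrightarrow> w \<in> W \<Longrightarrow> tensor_lift scale V W T \<tau> \<beta> (\<tau> v w) = \<beta> v w"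
    using g lift by auto
  show "f = tensor_lift scale V W T \<tau> \<beta>" if "f \<in> linmaps scale scale T UNIV"
    "\<And>v w. v \<in> V \<Longrightarrow> w \<in> W \<Longrightarrow> f (\<tau> v w) = \<beta> v w"
    using that ex1 \<open>?P UNIV g\<close> lift by blast
qed

text \<open>The description behind \<open>tensor_lift\<close> refers to the integrand at elements of
  the carrier only, so both sides describe the same map.\<close>

lemma sweedler_sum_cong:
  assumes "\<And>a b. a \<in> car C \<Longrightarrow> b \<in> car C \<Longrightarrow> \<beta> a b = \<beta>' a b"
  shows "sweedler_sum scale C \<beta> x = sweedler_sum scale C \<beta>' x"
proof -
  have "(\<forall>v\<in>car C. \<forall>w\<in>car C. g (tn C v w) = \<beta> v w) \<longleftrightarrow>
      (\<forall>v\<in>car C. \<forall>w\<in>car C. g (tn C v w) = \<beta>' v w)" for g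
    using assms by simp
  then show ?thesis
    unfolding sweedler_sum_def tensor_lift_def by simp
qed

lemma cocomm_coalgebraD:
  assumes "cocomm_coalgebra scale C"
  shows "subspace (car C)" "subspace (sq C)" "is_tensor scale (car C) (car C) (sq C) (tn C)"
    "restrict (comul C) (car C) \<in> linmaps scale scale (car C) (sq C)"
    "restrict (counit C) (car C) \<in> linmaps scale (*) (car C) UNIV"
  using assms unfolding cocomm_coalgebra_def is_tensor_def by blast+

lemma sweedler_sum_in_linmaps:
  assumes C: "cocomm_coalgebra scale C" and \<beta>: "bilinear_on scale (car C) (car C) X \<beta>"
    and X: "subspace X"
  shows "(\<lambda>x\<in>car C. sweedler_sum scale C \<beta> x) \<in> linmaps scale scale (car C) X"
  using cocomm_coalgebraD[OF C] tensor_lift_in_linmaps[OF _ \<beta> X]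
  by (simp add: restrict_in_linmaps_iff sweedler_sum_def) (simp add: linmaps_def PiE_iff)

text \<open>The comultiplication of x is a single pure tensor, on which the induced linear map takes
  the value of \<beta>.\<close>

lemma sweedler_sum_grouplike:
  assumes C: "cocomm_coalgebra scale C" and \<beta>: "bilinear_on scale (car C) (car C) X \<beta>"
    and X: "subspace X" and "x \<in> car C" "comul C x = tn C x x"
  shows "sweedler_sum scale C \<beta> x = \<beta> x x"
  using cocomm_coalgebraD[OF C] tensor_lift_tensor[OF _ \<beta> X] assms(4,5)
  by (simp add: sweedler_sum_def)

lemma bilinear_on_add:
  assumes "subspace V" "subspace W" "subspace X"
    and "bilinear_on scale V W X \<beta>" "bilinear_on scale V W X \<beta>'"
  shows "bilinear_on scale V W X (\<lambda>a b. \<beta> a b + \<beta>' a b)"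
  using assms by (simp add: bilinear_on_iff subspace_add algebra_simps)

lemma bilinear_on_scale:
  assumes "subspace V" "subspace W" "subspace X" and "bilinear_on scale V W X \<beta>"
  shows "bilinear_on scale V W X (\<lambda>a b. c *s \<beta> a b)"
  using assms by (simp add: bilinear_on_iff subspace_scale algebra_simps)

text \<open>The pointwise sum of the two induced maps is linear and has the right values on pure
  tensors, so uniqueness makes it the map induced by the sum.\<close>

lemma sweedler_sum_add:
  assumes C: "cocomm_coalgebra scale C" and X: "subspace X" and x: "x \<in> car C"
    and \<beta>: "bilinear_on scale (car C) (car C) X \<beta>" and \<beta>': "bilinear_on scale (car C) (car C) X \<beta>'"
  shows "sweedler_sum scale C (\<lambda>a b. \<beta> a b + \<beta>' a b) x =
    sweedler_sum scale C \<beta> x + sweedler_sum scale C \<beta>' x"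
proof -
  note [simp] = cocomm_coalgebraD[OF C]
  let ?lift = "tensor_lift scale (car C) (car C) (sq C) (tn C)"
  have tn: "tn C a b \<in> sq C" if "a \<in> car C" "b \<in> car C" for a b
    using cocomm_coalgebraD(3)[OF C] that by (auto simp: is_tensor_def bilinear_on_iff)
  have "(\<lambda>y\<in>sq C. ?lift \<beta> y + ?lift \<beta>' y) = ?lift (\<lambda>a b. \<beta> a b + \<beta>' a b)"
  proof (rule tensor_lift_unique[OF _ bilinear_on_add[OF _ _ X \<beta> \<beta>'] X])
    show "(\<lambda>y\<in>sq C. ?lift \<beta> y + ?lift \<beta>' y) \<in> linmaps scale scale (sq C) UNIV"
      using linmapsD[OF tensor_lift_in_linmaps[OF _ \<beta> X]] linmapsD[OF tensor_lift_in_linmaps[OF _ \<beta>' X]]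
      by (simp add: restrict_in_linmaps_iff algebra_simps)
  qed (use tn tensor_lift_tensor[OF _ \<beta> X] tensor_lift_tensor[OF _ \<beta>' X] in simp_all)
  then show ?thesis
    using x cocomm_coalgebraD(1,4)[OF C] unfolding sweedler_sum_def
    by (metis (no_types, lifting) restrict_apply' restrict_in_linmaps_iff)
qed

lemma sweedler_sum_scale:
  assumes C: "cocomm_coalgebra scale C" and X: "subspace X" and x: "x \<in> car C"
    and \<beta>: "bilinear_on scale (car C) (car C) X \<beta>"
  shows "sweedler_sum scale C (\<lambda>a b. c *s \<beta> a b) x = c *s sweedler_sum scale C \<beta> x"
proof -
  note [simp] = cocomm_coalgebraD[OF C]
  let ?lift = "tensor_lift scale (car C) (car C) (sq C) (tn C)"
  have tn: "tn C a b \<in> sq C" if "a \<in> car C" "b \<in> car C" for a b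
    using cocomm_coalgebraD(3)[OF C] that by (auto simp: is_tensor_def bilinear_on_iff)
  have "(\<lambda>y\<in>sq C. c *s ?lift \<beta> y) = ?lift (\<lambda>a b. c *s \<beta> a b)"
  proof (rule tensor_lift_unique[OF _ bilinear_on_scale[OF _ _ X \<beta>] X])
    show "(\<lambda>y\<in>sq C. c *s ?lift \<beta> y) \<in> linmaps scale scale (sq C) UNIV"
      using linmapsD[OF tensor_lift_in_linmaps[OF _ \<beta> X]]
      by (simp add: restrict_in_linmaps_iff algebra_simps)
  qed (use tn tensor_lift_tensor[OF _ \<beta> X] in simp_all)
  then show ?thesis
    using x cocomm_coalgebraD(1,4)[OF C] unfolding sweedler_sum_def
    by (metis (no_types, lifting) restrict_apply' restrict_in_linmaps_iff)
qed

section \<open>Multilinearity of contraction and weakening\<close>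

lemma multilinear_on_bilinear_on:
  assumes g: "multilinear_on scale (As @ V # U # Bs) W g"
    and sub: "\<forall>X\<in>set (As @ V # U # Bs). subspace X"
    and as: "list_all2 (\<in>) as As" and bs: "list_all2 (\<in>) bs Bs"
  shows "bilinear_on scale V U W (\<lambda>a b. g (as @ a # b # bs))"
proof -
  note lin = multilinear_on_linmaps[OF g sub]
  have "(\<lambda>b\<in>U. g (as @ a # b # bs)) \<in> linmaps scale scale U W" if "a \<in> V" for a
    using lin[of "As @ [V]" U Bs "as @ [a]" bs] that as bs by (simp add: list_all2_appendI)
  moreover have "(\<lambda>a\<in>V. g (as @ a # b # bs)) \<in> linmaps scale scale V W" if "b \<in> U" for b
    using lin[of As V "U # Bs" as "b # bs"] that as bs by simp
  ultimately show ?thesis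
    by (simp add: bilinear_on_def)
qed

text \<open>Here u plays the role of an argument that is not contracted. Linearity of h in u turns
  into sums and multiples of integrands, and the Sweedler sum is linear in its integrand.\<close>

lemma sweedler_sum_spectator:
  assumes C: "cocomm_coalgebra scale C" and W: "subspace W" and U: "subspace U" and x: "x \<in> car C"
    and bil: "\<And>u. u \<in> U \<Longrightarrow> bilinear_on scale (car C) (car C) W (\<lambda>a b. h a b u)"
    and lin: "\<And>a b. a \<in> car C \<Longrightarrow> b \<in> car C \<Longrightarrow> (\<lambda>u\<in>U. h a b u) \<in> linmaps scale scale U W"
  shows "(\<lambda>u\<in>U. sweedler_sum scale C (\<lambda>a b. h a b u) x) \<in> linmaps scale scale U W"
proof -
  have "sweedler_sum scale C (\<lambda>a b. h a b (u + v)) x =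
      sweedler_sum scale C (\<lambda>a b. h a b u + h a b v) x" if "u \<in> U" "v \<in> U" for u v
    using lin that by (intro sweedler_sum_cong) (simp add: restrict_in_linmaps_iff[OF U])
  moreover have "sweedler_sum scale C (\<lambda>a b. h a b (c *s u)) x =
      sweedler_sum scale C (\<lambda>a b. c *s h a b u) x" if "u \<in> U" for u c
    using lin that by (intro sweedler_sum_cong) (simp add: restrict_in_linmaps_iff[OF U])
  moreover have "sweedler_sum scale C (\<lambda>a b. h a b u) x \<in> W" if "u \<in> U" for u
    using sweedler_sum_in_linmaps[OF C bil W] that x cocomm_coalgebraD(1)[OF C]
    by (simp add: restrict_in_linmaps_iff)
  ultimately show ?thesis
    using bil sweedler_sum_add[OF C W x] sweedler_sum_scale[OF C W x]
    by (simp add: restrict_in_linmaps_iff[OF U])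
qed

text \<open>In the contracted slot, linearity comes from the comultiplication followed by the map
  induced on the tensor square; in the other slots it comes from
  \<open>sweedler_sum_spectator\<close>.\<close>

lemma multilinear_on_contraction:
  assumes C: "cocomm_coalgebra scale C" and W: "subspace W"
    and g: "multilinear_on scale (As @ car C # car C # Bs) W g"
    and sub: "\<forall>X\<in>set (As @ Bs). subspace X" and i: "i = length As"
  shows "multilinear_on scale (As @ car C # Bs) W
    (\<lambda>xs. sweedler_sum scale C (\<lambda>a b. g (splice_at i [a, b] xs)) (xs ! i))"
proof (rule multilinear_on_middleI)
  have sub': "\<forall>X\<in>set (As @ car C # car C # Bs). subspace X"
    using sub cocomm_coalgebraD(1)[OF C] by auto
  note lin = multilinear_on_linmaps[OF g sub'] and bil = multilinear_on_bilinear_on[OF g sub']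
  show "\<forall>X\<in>set (As @ car C # Bs). subspace X" using sub' by auto
  {
    fix as assume as: "list_all2 (\<in>) as As"
    then have i': "i = length as" by (simp add: list_all2_lengthD i)
    {
      fix bs assume bs: "list_all2 (\<in>) bs Bs"
      show *: "(\<lambda>x\<in>car C. sweedler_sum scale C (\<lambda>a b. g (splice_at i [a, b] (as @ x # bs)))
          ((as @ x # bs) ! i)) \<in> linmaps scale scale (car C) W"
        using sweedler_sum_in_linmaps[OF C bil[OF as bs] W] by (simp add: splice_at_append i')
      show "sweedler_sum scale C (\<lambda>a b. g (splice_at i [a, b] (as @ x # bs)))
          ((as @ x # bs) ! i) \<in> W" if "x \<in> car C" for x
        using * that by (simp only: restrict_in_linmaps_iff[OF cocomm_coalgebraD(1)[OF C]])
    next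
      fix B1 U B2 x b1 b2
      assume B: "Bs = B1 @ U # B2" and x: "x \<in> car C"
        and b1: "list_all2 (\<in>) b1 B1" and b2: "list_all2 (\<in>) b2 B2"
      have "(\<lambda>u\<in>U. sweedler_sum scale C (\<lambda>a b. g (as @ a # b # b1 @ u # b2)) x)
          \<in> linmaps scale scale U W"
      proof (rule sweedler_sum_spectator[OF C W _ x])
        show "subspace U" using sub B by auto
        show "bilinear_on scale (car C) (car C) W (\<lambda>a b. g (as @ a # b # b1 @ u # b2))"
          if "u \<in> U" for u
          using that as b1 b2 B by (intro bil) (simp_all add: list_all2_appendI)
        show "(\<lambda>u\<in>U. g (as @ a # b # b1 @ u # b2)) \<in> linmaps scale scale U W"
          if "a \<in> car C" "b \<in> car C" for a b
          using lin[of "As @ car C # car C # B1" U B2 "as @ a # b # b1" b2] that as b1 b2 B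
          by (simp add: list_all2_appendI)
      qed
      then show "(\<lambda>u\<in>U. sweedler_sum scale C (\<lambda>a b. g (splice_at i [a, b] (as @ x # b1 @ u # b2)))
          ((as @ x # b1 @ u # b2) ! i)) \<in> linmaps scale scale U W"
        by (simp add: splice_at_append i')
    }
  next
    fix A1 U A2 a1 a2 x bs
    assume A: "As = A1 @ U # A2" and a1: "list_all2 (\<in>) a1 A1" and a2: "list_all2 (\<in>) a2 A2"
      and x: "x \<in> car C" and bs: "list_all2 (\<in>) bs Bs"
    \<comment> \<open>The length of the prefix does not depend on u, so the contracted slot holds x
      for every u.\<close>
    have i': "i = length (a1 @ u # a2)" for u
      using a1 a2 A i by (simp add: list_all2_lengthD)
    then have nth: "(a1 @ u # a2 @ x # bs) ! i = x" for u
      using nth_append_length[of "a1 @ u # a2" x bs] by simp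
    have "(\<lambda>u\<in>U. sweedler_sum scale C (\<lambda>a b. g (a1 @ u # a2 @ a # b # bs)) x)
        \<in> linmaps scale scale U W"
    proof (rule sweedler_sum_spectator[OF C W _ x])
      show "subspace U" using sub A by auto
      show "bilinear_on scale (car C) (car C) W (\<lambda>a b. g (a1 @ u # a2 @ a # b # bs))"
        if "u \<in> U" for u
        using bil[of "a1 @ u # a2" bs] that a1 a2 bs A by (simp add: list_all2_appendI)
      show "(\<lambda>u\<in>U. g (a1 @ u # a2 @ a # b # bs)) \<in> linmaps scale scale U W"
        if "a \<in> car C" "b \<in> car C" for a b
        using lin[of A1 U "A2 @ car C # car C # Bs" a1 "a2 @ a # b # bs"] that a1 a2 bs A
        by (simp add: list_all2_appendI)
    qed
    moreover have "sweedler_sum scale C (\<lambda>a b. g (splice_at i [a, b] (a1 @ u # a2 @ x # bs)))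
        ((a1 @ u # a2 @ x # bs) ! i) = sweedler_sum scale C (\<lambda>a b. g (a1 @ u # a2 @ a # b # bs)) x" for u
      using splice_at_append[OF i', of _ u x bs] nth[of u] by simp
    ultimately show "(\<lambda>u\<in>U. sweedler_sum scale C
        (\<lambda>a b. g (splice_at i [a, b] (a1 @ u # a2 @ x # bs))) ((a1 @ u # a2 @ x # bs) ! i))
      \<in> linmaps scale scale U W"
      by simp
  }
qed

text \<open>In the weakened slot the result is a fixed vector times the linear counit; in any other
  slot it is a linear map times a fixed scalar.\<close>

lemma multilinear_on_weakening:
  assumes C: "cocomm_coalgebra scale C" and W: "subspace W"
    and g: "multilinear_on scale (As @ Bs) W g"
    and sub: "\<forall>X\<in>set (As @ Bs). subspace X" and i: "i = length As"
  shows "multilinear_on scale (As @ car C # Bs) W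
    (\<lambda>xs. counit C (xs ! i) *s g (splice_at i [] xs))"
proof (rule multilinear_on_middleI)
  note lin = multilinear_on_linmaps[OF g sub] and subC = cocomm_coalgebraD(1)[OF C]
  show "\<forall>X\<in>set (As @ car C # Bs). subspace X" using sub subC by auto
  {
    fix as assume as: "list_all2 (\<in>) as As"
    then have i': "i = length as" by (simp add: list_all2_lengthD i)
    {
      fix bs assume bs: "list_all2 (\<in>) bs Bs"
      then have "g (as @ bs) \<in> W"
        using as by (intro multilinear_on_value[OF g]) (simp add: list_all2_appendI)
      then show *: "(\<lambda>x\<in>car C. counit C ((as @ x # bs) ! i) *s g (splice_at i [] (as @ x # bs)))
          \<in> linmaps scale scale (car C) W"
        using cocomm_coalgebraD(5)[OF C] W
        by (simp add: restrict_in_linmaps_iff[OF subC] splice_at_append i' subspace_scale algebra_simps)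
      show "counit C ((as @ x # bs) ! i) *s g (splice_at i [] (as @ x # bs)) \<in> W"
        if "x \<in> car C" for x
        using * that by (simp only: restrict_in_linmaps_iff[OF subC])
    next
      fix B1 U B2 x b1 b2
      assume B: "Bs = B1 @ U # B2" and x: "x \<in> car C"
        and b1: "list_all2 (\<in>) b1 B1" and b2: "list_all2 (\<in>) b2 B2"
      moreover have "subspace U" using sub B by auto
      ultimately show "(\<lambda>u\<in>U. counit C ((as @ x # b1 @ u # b2) ! i) *s
          g (splice_at i [] (as @ x # b1 @ u # b2))) \<in> linmaps scale scale U W"
        using lin[of "As @ B1" U B2 "as @ b1" b2] as W
        by (simp add: restrict_in_linmaps_iff splice_at_append i' subspace_scale list_all2_appendI
            algebra_simps)
    }
  next
    fix A1 U A2 a1 a2 x bs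
    assume A: "As = A1 @ U # A2" and a1: "list_all2 (\<in>) a1 A1" and a2: "list_all2 (\<in>) a2 A2"
      and x: "x \<in> car C" and bs: "list_all2 (\<in>) bs Bs"
    have i': "i = length (a1 @ u # a2)" for u
      using a1 a2 A i by (simp add: list_all2_lengthD)
    then have nth: "(a1 @ u # a2 @ x # bs) ! i = x" for u
      using nth_append_length[of "a1 @ u # a2" x bs] by simp
    have "counit C ((a1 @ u # a2 @ x # bs) ! i) *s g (splice_at i [] (a1 @ u # a2 @ x # bs)) =
        counit C x *s g (a1 @ u # a2 @ bs)" for u
      using splice_at_append[OF i', of _ u x bs] nth[of u] by simp
    moreover have "subspace U" using sub A by auto
    ultimately show "(\<lambda>u\<in>U. counit C ((a1 @ u # a2 @ x # bs) ! i) *s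
        g (splice_at i [] (a1 @ u # a2 @ x # bs))) \<in> linmaps scale scale U W"
      using lin[of A1 U "A2 @ Bs" a1 "a2 @ bs"] a1 a2 bs A W
      by (simp add: restrict_in_linmaps_iff subspace_scale list_all2_appendI algebra_simps)
  }
qed

section \<open>Group-like elements\<close>

context
  fixes g :: 'b
  assumes nonzero: "g \<noteq> 0"
begin

lemma independent_line: "independent {g}"
  using nonzero by (simp add: dependent_single)

lemma line_coord_simps [simp]:
  "line_coord scale g g = 1"
  "v \<in> span {g} \<Longrightarrow> w \<in> span {g} \<Longrightarrow> line_coord scale g (v + w) = line_coord scale g v + line_coord scale g w"
  "v \<in> span {g} \<Longrightarrow> line_coord scale g (c *s v) = c * line_coord scale g v"
  by (simp_all add: line_coord_def representation_basis representation_add representation_scale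
      independent_line nonzero)

lemma line_coord_scale: "v \<in> span {g} \<Longrightarrow> line_coord scale g v *s g = v"
  by (auto simp: span_singleton line_coord_simps(3)[OF span_base])

text \<open>Both arguments are multiples of g, so \<beta> is determined by its value at the pair of
  g with itself.\<close>

lemma bilinear_on_line:
  assumes \<beta>: "bilinear_on scale (span {g}) (span {g}) X \<beta>" and v: "v \<in> span {g}" and w: "w \<in> span {g}"
  shows "\<beta> v w = line_coord scale g v *s (line_coord scale g w *s \<beta> g g)"
proof -
  have "g \<in> span {g}" by (simp add: span_base)
  then have "\<beta> (a *s g) (b *s g) = a *s (b *s \<beta> g g)" for a b
    using \<beta> by (simp add: bilinear_on_iff span_scale)
  then show ?thesis
    using line_coord_scale[OF v] line_coord_scale[OF w] by metis
qed

lemma is_tensor_line: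
  "is_tensor scale (span {g}) (span {g}) (span {g}) (\<lambda>v w. line_coord scale g v *s w)"
  unfolding is_tensor_def
proof (intro conjI allI impI)
  show "bilinear_on scale (span {g}) (span {g}) (span {g}) (\<lambda>v w. line_coord scale g v *s w)"
    by (auto simp: bilinear_on_iff span_scale algebra_simps)
next
  fix X \<beta>
  assume *: "subspace X \<and> bilinear_on scale (span {g}) (span {g}) X \<beta>"
  have g: "g \<in> span {g}" by (simp add: span_base)
  show "\<exists>!f. f \<in> linmaps scale scale (span {g}) X \<and>
      (\<forall>v\<in>span {g}. \<forall>w\<in>span {g}. f (line_coord scale g v *s w) = \<beta> v w)"
  \<comment> \<open>In this encoding v \<otimes> g is v itself, so the induced map has to send v to
    \<open>\<beta> v g\<close>. Bilinearity then gives its values at all other pure tensors.\<close>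
  proof (rule ex1I[of _ "\<lambda>v\<in>span {g}. \<beta> v g"], intro conjI ballI)
    show "(\<lambda>v\<in>span {g}. \<beta> v g) \<in> linmaps scale scale (span {g}) X"
      using * g by (simp add: restrict_in_linmaps_iff bilinear_on_iff)
    fix v w assume v: "v \<in> span {g}" and w: "w \<in> span {g}"
    show "(\<lambda>v\<in>span {g}. \<beta> v g) (line_coord scale g v *s w) = \<beta> v w"
      using bilinear_on_line[OF conjunct2[OF *] v w]
        bilinear_on_line[OF conjunct2[OF *] span_scale[OF w] g] v w g
      by (simp add: span_scale)
  next
    fix f assume f: "f \<in> linmaps scale scale (span {g}) X \<and>
      (\<forall>v\<in>span {g}. \<forall>w\<in>span {g}. f (line_coord scale g v *s w) = \<beta> v w)"
    have "f v = \<beta> v g" if v: "v \<in> span {g}" for v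
    proof -
      have "f (line_coord scale g v *s g) = \<beta> v g"
        using f v g by blast
      then show ?thesis
        by (simp add: line_coord_scale v)
    qed
    then show "f = (\<lambda>v\<in>span {g}. \<beta> v g)"
      using f by (auto simp: linmaps_def fun_eq_iff PiE_iff extensional_def)
  qed
qed simp

text \<open>The comultiplication of v is v, which is the pure tensor v \<otimes> g.\<close>

lemma sweedler_sum_line:
  assumes \<beta>: "bilinear_on scale (span {g}) (span {g}) UNIV \<beta>" and v: "v \<in> span {g}"
  shows "sweedler_sum scale (line_coalgebra scale g) \<beta> v = \<beta> v g"
proof -
  have g: "g \<in> span {g}" by (simp add: span_base)
  have "tensor_lift scale (span {g}) (span {g}) (span {g}) (\<lambda>v w. line_coord scale g v *s w) \<beta>
      (line_coord scale g v *s g) = \<beta> v g"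
    using tensor_lift_tensor[OF is_tensor_line \<beta> subspace_UNIV subspace_span subspace_span v g] .
  then show ?thesis
    using v by (simp add: sweedler_sum_def line_coalgebra_def line_coord_scale)
qed

text \<open>By \<open>sweedler_sum_line\<close> each law becomes an evaluation of the second factor
  at g, whose coordinate is 1. The triple tensor product is modelled by the same line once
  more.\<close>

lemma cocomm_coalgebra_line: "cocomm_coalgebra scale (line_coalgebra scale g)"
proof -
  let ?L = "line_coalgebra scale g"
  have g: "g \<in> span {g}" by (simp add: span_base)
  have bil: "bilinear_on scale (span {g}) (span {g}) UNIV (\<lambda>a b. line_coord scale g a *s b)"
    by (auto simp: bilinear_on_iff span_scale algebra_simps)
  have "bilinear_on scale (span {g}) (span {g}) UNIV (\<lambda>a b. line_coord scale g b *s a)"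
    by (auto simp: bilinear_on_iff span_scale algebra_simps)
  note sum = sweedler_sum_line[OF bil] sweedler_sum_line[OF this]
  have inner: "sweedler_sum scale ?L (\<lambda>b' b''. line_coord scale g (line_coord scale g a *s b') *s b'') b =
      line_coord scale g a *s b" if "a \<in> span {g}" "b \<in> span {g}" for a b
  proof -
    have "bilinear_on scale (span {g}) (span {g}) UNIV
        (\<lambda>b' b''. line_coord scale g (line_coord scale g a *s b') *s b'')"
      by (auto simp: bilinear_on_iff span_scale algebra_simps scale_left_commute)
    then show ?thesis
      using that by (simp add: sweedler_sum_line line_coord_scale flip: scale_scale)
  qed
  \<comment> \<open>The inner sum is a \<otimes> b, which the identity comultiplication also gives
    on the other side of the coassociativity law.\<close>
  have coassoc: "sweedler_sum scale ?L
      (\<lambda>a b. sweedler_sum scale ?L (\<lambda>b' b''. line_coord scale g (line_coord scale g a *s b') *s b'') b) v =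
      sweedler_sum scale ?L (\<lambda>a b. line_coord scale g a *s b) v" for v
    by (rule sweedler_sum_cong) (simp add: inner)
  have tensor: "is_tensor scale (span {g}) (span {g}) (span {g}) (tn ?L)"
    using is_tensor_line by (simp add: line_coalgebra_def)
  have "\<exists>L \<sigma>. is_tensor scale (sq ?L) (car ?L) L \<sigma> \<and>
      (\<forall>x\<in>car ?L. sweedler_sum scale ?L (\<lambda>a b. \<sigma> (comul ?L a) b) x =
        sweedler_sum scale ?L (\<lambda>a b. sweedler_sum scale ?L (\<lambda>b' b''. \<sigma> (tn ?L a b') b'') b) x)"
    using tensor coassoc by (intro exI[of _ "span {g}"] exI[of _ "tn ?L"]) simp
  then show ?thesis
    using tensor unfolding cocomm_coalgebra_def
    by (simp add: restrict_in_linmaps_iff sum line_coord_scale)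
qed

end

text \<open>Coalgebra morphisms preserve group-like elements. The image of g under the lift of the
  linear map sending g to P is therefore group-like and lies over P.\<close>

lemma cofree_grouplike:
  fixes g :: 'b
  assumes cofree: "is_cofree scale V C d" and V: "subspace V" and P: "P \<in> V" and g: "g \<noteq> 0"
  obtains x where "x \<in> car C" "d x = P" "counit C x = 1" "comul C x = tn C x x"
proof -
  let ?L = "line_coalgebra scale g" and ?f = "\<lambda>v\<in>span {g}. line_coord scale g v *s P"
  have C: "cocomm_coalgebra scale C" using cofree by (simp add: is_cofree_def)
  have gL: "g \<in> span {g}" by (simp add: span_base)
  have "?f \<in> linmaps scale scale (car ?L) V"
    using g P V by (simp add: restrict_in_linmaps_iff subspace_scale algebra_simps)
  then obtain \<phi> where \<phi>: "\<phi> \<in> coalg_morphisms scale ?L C" "\<forall>x\<in>car ?L. d (\<phi> x) = ?f x"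
    using cofree cocomm_coalgebra_line[OF g] unfolding is_cofree_def by blast
  have lin: "\<phi> \<in> linmaps scale scale (span {g}) (car C)"
    and counit: "counit C (\<phi> g) = 1"
    and comul: "comul C (\<phi> g) = sweedler_sum scale ?L (\<lambda>a b. tn C (\<phi> a) (\<phi> b)) g"
    using \<phi>(1) g gL unfolding coalg_morphisms_def by auto
  have "bilinear_on scale (span {g}) (span {g}) UNIV (\<lambda>a b. tn C (\<phi> a) (\<phi> b))"
    using cocomm_coalgebraD[OF C] linmapsD[OF lin] unfolding is_tensor_def
    by (simp add: bilinear_on_iff)
  then have "comul C (\<phi> g) = tn C (\<phi> g) (\<phi> g)"
    using comul sweedler_sum_line[OF g _ gL] by simp
  moreover have "d (\<phi> g) = P"
    using \<phi>(2) gL g by simp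
  ultimately show ?thesis
    using that counit linmapsD(1)[OF lin gL] by blast
qed

section \<open>Denotations of binary integers\<close>

lemma subspace_sp: "sweedler_semantics scale I A \<Longrightarrow> subspace (sp I A)"
  by (induction A)
    (auto simp: is_tensor_def is_direct_sum_def is_hom_space_def is_cofree_def cocomm_coalgebra_def)

section \<open>Spaces of linear maps and currying\<close>

lemma hom_space_eqI:
  assumes "is_hom_space scale V W H ev" "h \<in> H" "h' \<in> H" "\<And>x. x \<in> V \<Longrightarrow> ev h x = ev h' x"
  shows "h = h'"
proof -
  have "ev h \<in> linmaps scale scale V W" "ev h' \<in> linmaps scale scale V W" "inj_on ev H"
    using assms by (auto simp: is_hom_space_def bij_betw_def)
  then show ?thesis
    using linmaps_eqI assms by (metis inj_onD)
qed

lemma hom_space_inv_into: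
  assumes "is_hom_space scale V W H ev" "f \<in> linmaps scale scale V W"
  shows "inv_into H ev f \<in> H" "ev (inv_into H ev f) = f"
  using assms unfolding is_hom_space_def
  by (metis bij_betw_def inv_into_into f_inv_into_f)+

text \<open>This is the semantics of \<open>LolliR\<close>, which abstracts the last argument.
  Linearity of g in that argument ensures that \<open>inv_into\<close> returns a genuine preimage;
  linearity of the result in the remaining arguments is checked by evaluating at each a.\<close>

lemma
  assumes H: "is_hom_space scale V W H ev" and g: "multilinear_on scale (Vs @ [V]) W g"
    and sub: "\<forall>X\<in>set (Vs @ [V]). subspace X"
  shows multilinear_on_curry:
      "multilinear_on scale Vs H (\<lambda>xs. inv_into H ev (\<lambda>a\<in>V. g (xs @ [a])))"
    and ev_curry: "list_all2 (\<in>) xs Vs \<Longrightarrow> a \<in> V \<Longrightarrow>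
      ev (inv_into H ev (\<lambda>a\<in>V. g (xs @ [a]))) a = g (xs @ [a])"
proof -
  let ?c = "\<lambda>xs. inv_into H ev (\<lambda>a\<in>V. g (xs @ [a]))"
  have lin: "(\<lambda>a\<in>V. g (xs @ [a])) \<in> linmaps scale scale V W" if "list_all2 (\<in>) xs Vs" for xs
    using multilinear_on_linmaps[OF g sub, of Vs V "[]" xs "[]"] that by simp
  note cH = hom_space_inv_into(1)[OF H lin]
  show ev: "ev (?c xs) a = g (xs @ [a])" if "list_all2 (\<in>) xs Vs" "a \<in> V" for xs a
    using hom_space_inv_into(2)[OF H lin] that by simp
  have subH: "subspace H" and ev_add: "\<And>h h' x. h \<in> H \<Longrightarrow> h' \<in> H \<Longrightarrow> x \<in> V \<Longrightarrow>
      ev (h + h') x = ev h x + ev h' x"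
    and ev_scale: "\<And>c h x. h \<in> H \<Longrightarrow> x \<in> V \<Longrightarrow> ev (c *s h) x = c *s ev h x"
    using H by (auto simp: is_hom_space_def)
  have "(\<lambda>u\<in>U. ?c (as @ u # bs)) \<in> linmaps scale scale U H"
    if Vs: "Vs = As @ U # Bs" and as: "list_all2 (\<in>) as As" and bs: "list_all2 (\<in>) bs Bs"
    for As U Bs as bs
  proof -
    have U: "subspace U" using sub Vs by auto
    define c where "c u = ?c (as @ u # bs)" for u
    have args: "list_all2 (\<in>) (as @ u # bs) Vs" if "u \<in> U" for u
      using that as bs Vs by (simp add: list_all2_appendI)
    have c_in: "c u \<in> H" and c_ev: "a \<in> V \<Longrightarrow> ev (c u) a = g (as @ u # bs @ [a])"
      if "u \<in> U" for u a
      using cH[OF args[OF that]] ev[OF args[OF that]] by (simp_all add: c_def)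
    have "(\<lambda>u\<in>U. g (as @ u # bs @ [a])) \<in> linmaps scale scale U W" if "a \<in> V" for a
      using multilinear_on_linmaps[OF g sub, of As U "Bs @ [V]" as "bs @ [a]"] that Vs as bs
      by (simp add: list_all2_appendI)
    then have g_add: "u \<in> U \<Longrightarrow> v \<in> U \<Longrightarrow> a \<in> V \<Longrightarrow>
        g (as @ (u + v) # bs @ [a]) = g (as @ u # bs @ [a]) + g (as @ v # bs @ [a])"
      and g_scale: "u \<in> U \<Longrightarrow> a \<in> V \<Longrightarrow>
        g (as @ (k *s u) # bs @ [a]) = k *s g (as @ u # bs @ [a])" for u v a k
      by (simp_all add: restrict_in_linmaps_iff[OF U])
    have "c (u + v) = c u + c v" if "u \<in> U" "v \<in> U" for u v
      by (rule hom_space_eqI[OF H])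
        (use that c_in subH U in \<open>simp_all add: c_ev g_add ev_add subspace_add\<close>)
    moreover have "c (k *s u) = k *s c u" if "u \<in> U" for u k
      by (rule hom_space_eqI[OF H])
        (use that c_in subH U in \<open>simp_all add: c_ev g_scale ev_scale subspace_scale\<close>)
    ultimately have "(\<lambda>u\<in>U. c u) \<in> linmaps scale scale U H"
      using c_in by (simp add: restrict_in_linmaps_iff[OF U])
    then show ?thesis
      by (simp only: c_def)
  qed
  then show "multilinear_on scale Vs H ?c"
    using cH multilinear_on_iff[of Vs H] sub by auto
qed

section \<open>Structural rules in the derivation of a binary integer\<close>

lemma multilinear_on_move_right:
  assumes "multilinear_on scale (As @ V # Us @ Bs) W (den scale I \<pi>)"
    and "\<forall>X\<in>set (As @ V # Us @ Bs). subspace X"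
  shows "multilinear_on scale (As @ Us @ V # Bs) W
    (den scale I (move_right (length As) (length Us) \<pi>))"
  using assms
proof (induction Us arbitrary: As \<pi>)
  case (Cons U Us)
  have "multilinear_on scale ((As @ [U]) @ V # Us @ Bs) W (den scale I (Exch (length As) \<pi>))"
    using multilinear_on_exchange[of As V U "Us @ Bs" W "den scale I \<pi>"] Cons.prems by simp
  from Cons.IH[OF this] show ?case
    using Cons.prems by simp
qed simp

text \<open>Rules carry hypotheses from premise to conclusion, whereas denotations carry arguments
  back: the argument z standing after \<open>ys\<close> is handed to \<pi> in front of them.\<close>

lemma den_move_right:
  "i = length as \<Longrightarrow> den scale I (move_right i (length ys) \<pi>) (as @ ys @ z # bs) =
    den scale I \<pi> (as @ z # ys @ bs)"
proof (induction ys arbitrary: i as \<pi>)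
  case (Cons y ys)
  then show ?case
    using Cons.IH[of "Suc i" "as @ [y]" "Exch i \<pi>"] by (simp add: exchange_append)
qed simp

text \<open>Without copies, weakening contributes the counit, which is 1 at x; each contraction
  duplicates x. Multilinearity of \<pi> makes the integrand of the Sweedler sum bilinear, so that
  this sum can be evaluated.\<close>

lemma
  assumes C: "cocomm_coalgebra scale (bang I B)" and W: "subspace W"
    and sub: "\<forall>X\<in>set (As @ Bs). subspace X" and i: "i = length As"
    and \<pi>: "multilinear_on scale (As @ replicate m (car (bang I B)) @ Bs) W (den scale I \<pi>)"
  shows multilinear_on_contract:
      "multilinear_on scale (As @ car (bang I B) # Bs) W (den scale I (contract i B m \<pi>))"
    and den_contract:
      "list_all2 (\<in>) as As \<Longrightarrow> list_all2 (\<in>) bs Bs \<Longrightarrow> x \<in> car (bang I B) \<Longrightarrow>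
       counit (bang I B) x = 1 \<Longrightarrow> comul (bang I B) x = tn (bang I B) x x \<Longrightarrow>
       den scale I (contract i B m \<pi>) (as @ x # bs) = den scale I \<pi> (as @ replicate m x @ bs)"
proof -
  let ?C = "bang I B"
  have "multilinear_on scale (As @ car ?C # Bs) W (den scale I (contract i B m \<pi>)) \<and>
    (list_all2 (\<in>) as As \<longrightarrow> list_all2 (\<in>) bs Bs \<longrightarrow> x \<in> car ?C \<longrightarrow>
       counit ?C x = 1 \<longrightarrow> comul ?C x = tn ?C x x \<longrightarrow>
       den scale I (contract i B m \<pi>) (as @ x # bs) = den scale I \<pi> (as @ replicate m x @ bs))"
    using \<pi>
  proof (induction m arbitrary: \<pi> rule: induct_nat_012)
    case 0
    then show ?case
      using multilinear_on_weakening[OF C W _ sub i] i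
      by (auto simp: splice_at_append nth_append dest: list_all2_lengthD)
  next
    case 1
    then show ?case by simp
  next
    case (ge2 m)
    have sub': "\<forall>X\<in>set (As @ replicate m (car ?C) @ Bs). subspace X"
      using sub cocomm_coalgebraD(1)[OF C] by auto
    have \<pi>: "multilinear_on scale (As @ car ?C # car ?C # replicate m (car ?C) @ Bs) W (den scale I \<pi>)"
      using ge2(3) by simp
    \<comment> \<open>The induction hypothesis is applied to the derivation extended by one
      contraction, so multilinearity has to be reestablished for it.\<close>
    have "multilinear_on scale (As @ replicate (Suc m) (car ?C) @ Bs) W (den scale I (Ctr i B \<pi>))"
      using multilinear_on_contraction[OF C W \<pi> _ i] sub' by simp
    note IH = ge2(2)[OF this]
    have "den scale I (Ctr i B \<pi>) (as @ x # replicate m x @ bs) =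
        den scale I \<pi> (as @ x # x # replicate m x @ bs)"
      if "list_all2 (\<in>) as As" "list_all2 (\<in>) bs Bs" "x \<in> car ?C" "comul ?C x = tn ?C x x"
    proof -
      have "list_all2 (\<in>) (replicate m x @ bs) (replicate m (car ?C) @ Bs)"
        using that by (intro list_all2_appendI) (auto simp: list_all2_conv_all_nth)
      then have "bilinear_on scale (car ?C) (car ?C) W (\<lambda>a b. den scale I \<pi> (as @ a # b # replicate m x @ bs))"
        using multilinear_on_bilinear_on[OF \<pi>] sub' cocomm_coalgebraD(1)[OF C] that(1) by simp
      from sweedler_sum_grouplike[OF C this W that(3,4)] show ?thesis
        using that(1) i by (auto simp: splice_at_append nth_append dest: list_all2_lengthD)
    qed
    then show ?case
      using IH by simp
  qed
  then show "multilinear_on scale (As @ car ?C # Bs) W (den scale I (contract i B m \<pi>))"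
    and "list_all2 (\<in>) as As \<Longrightarrow> list_all2 (\<in>) bs Bs \<Longrightarrow> x \<in> car (bang I B) \<Longrightarrow>
       counit (bang I B) x = 1 \<Longrightarrow> comul (bang I B) x = tn (bang I B) x x \<Longrightarrow>
       den scale I (contract i B m \<pi>) (as @ x # bs) = den scale I \<pi> (as @ replicate m x @ bs)"
    by auto
qed

section \<open>Application of derelicted hypotheses\<close>

lemma den_apply:
  "length ys = length (ctx \<pi>) \<Longrightarrow> den scale I (Der 0 (LolliL \<pi> (Ax A))) (x # ys) =
    app I (concl \<pi>) A (der I (Lolli (concl \<pi>) A) x) (den scale I \<pi> ys)"
  by simp

text \<open>The head slot is linear because dereliction is linear and evaluation is linear in the
  element of the hom space. The other slots are linear because that element stands for a linear map,
  applied after \<pi>.\<close>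

lemma multilinear_on_apply:
  assumes hom: "is_hom_space scale V W (sp I (Lolli (concl \<pi>) A)) (app I (concl \<pi>) A)"
    and der: "restrict (der I (Lolli (concl \<pi>) A)) D \<in> linmaps scale scale D (sp I (Lolli (concl \<pi>) A))"
    and \<pi>: "multilinear_on scale Vs V (den scale I \<pi>)" and len: "length (ctx \<pi>) = length Vs"
    and sub: "\<forall>X\<in>set (D # Vs). subspace X" "subspace V"
  shows "multilinear_on scale (D # Vs) W (den scale I (Der 0 (LolliL \<pi> (Ax A))))"
proof -
  let ?g = "den scale I (Der 0 (LolliL \<pi> (Ax A)))"
    and ?d = "der I (Lolli (concl \<pi>) A)" and ?ev = "app I (concl \<pi>) A"
    and ?H = "sp I (Lolli (concl \<pi>) A)"
  have D: "subspace D" using sub by simp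
  have d: "x \<in> D \<Longrightarrow> ?d x \<in> ?H" "x \<in> D \<Longrightarrow> y \<in> D \<Longrightarrow> ?d (x + y) = ?d x + ?d y"
    "x \<in> D \<Longrightarrow> ?d (c *s x) = c *s ?d x" for x y c
    using der by (simp_all add: restrict_in_linmaps_iff[OF D])
  have ev: "x \<in> D \<Longrightarrow> ?ev (?d x) \<in> linmaps scale scale V W"
    and ev_add: "x \<in> D \<Longrightarrow> y \<in> D \<Longrightarrow> v \<in> V \<Longrightarrow>
      ?ev (?d x + ?d y) v = ?ev (?d x) v + ?ev (?d y) v"
    and ev_scale: "x \<in> D \<Longrightarrow> v \<in> V \<Longrightarrow> ?ev (c *s ?d x) v = c *s ?ev (?d x) v" for x y v c
    using hom d(1) by (auto simp: is_hom_space_def bij_betw_def)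
  have g: "?g (x # ys) = ?ev (?d x) (den scale I \<pi> ys)" if "list_all2 (\<in>) ys Vs" for x ys
    using that len by (intro den_apply) (simp add: list_all2_lengthD)
  note val = multilinear_on_value[OF \<pi>]
  have "multilinear_on scale ([] @ D # Vs) W ?g"
  proof (rule multilinear_on_middleI)
    fix as :: "'b list" and bs assume as: "list_all2 (\<in>) as []" and bs: "list_all2 (\<in>) bs Vs"
    show "?g (as @ x # bs) \<in> W" if "x \<in> D" for x
      using as that linmapsD(1)[OF ev val[OF bs]] by (simp del: den.simps add: g[OF bs])
    show "(\<lambda>x\<in>D. ?g (as @ x # bs)) \<in> linmaps scale scale D W"
      using as linmapsD(1)[OF ev val[OF bs]] val[OF bs]
      by (simp del: den.simps add: g[OF bs] restrict_in_linmaps_iff[OF D] d ev_add ev_scale)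
  next
    fix B1 U B2 x b1 b2 and as :: "'b list"
    assume Vs: "Vs = B1 @ U # B2" and as: "list_all2 (\<in>) as []" and x: "x \<in> D"
      and b: "list_all2 (\<in>) b1 B1" "list_all2 (\<in>) b2 B2"
    have U: "subspace U" using sub Vs by simp
    have lin: "(\<lambda>u\<in>U. den scale I \<pi> (b1 @ u # b2)) \<in> linmaps scale scale U V"
      using multilinear_on_linmaps[OF \<pi> _ Vs b] sub by simp
    have "list_all2 (\<in>) (b1 @ u # b2) Vs" if "u \<in> U" for u
      using that b Vs by (simp add: list_all2_appendI)
    then have g': "?g (as @ x # b1 @ u # b2) = ?ev (?d x) (den scale I \<pi> (b1 @ u # b2))"
      if "u \<in> U" for u
      using as g that by (simp del: den.simps)
    show "(\<lambda>u\<in>U. ?g (as @ x # b1 @ u # b2)) \<in> linmaps scale scale U W"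
      using lin linmapsD[OF ev[OF x]] U
      by (simp del: den.simps add: g' restrict_in_linmaps_iff subspace_add subspace_scale)
  qed (use sub in simp_all)
  then show ?thesis by simp
qed

text \<open>Each digit adds an application whose hypothesis enters in front of all others; for digit
  1 it is then moved past the hypotheses of digit 0, which keeps the two blocks contiguous. The head
  of S is applied last, hence \<open>foldr\<close>.\<close>

lemma
  fixes I :: "('p, 'a, 'b) semantics" and A :: "'p form"
  defines "C \<equiv> bang I (Lolli A A)"
  assumes hom: "is_hom_space scale (sp I A) (sp I A) (sp I (Lolli A A)) (app I A A)"
    and der: "restrict (der I (Lolli A A)) (car C) \<in> linmaps scale scale (car C) (sp I (Lolli A A))"
    and sub: "subspace (car C)" "subspace (sp I A)"
  shows multilinear_on_occurrences: "multilinear_on scale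
      (replicate (count_list S False) (car C) @ replicate (count_list S True) (car C) @ [sp I A])
      (sp I A) (den scale I (occurrences A S))"
    and den_occurrences: "den scale I (occurrences A S)
      (replicate (count_list S False) x0 @ replicate (count_list S True) x1 @ [a]) =
      foldr (\<lambda>b. app I A A (der I (Lolli A A) (if b then x1 else x0))) S a"
proof (induction S)
  case Nil
  {
    case 1
    show ?case
      using sub(2) by (auto simp: multilinear_on_iff restrict_in_linmaps_iff list_all2_Cons2
          Cons_eq_append_conv)
  next
    case 2
    show ?case by simp
  }
next
  case (Cons b S)
  let ?n0 = "count_list S False" and ?n1 = "count_list S True"
  let ?Vs = "replicate ?n0 (car C) @ replicate ?n1 (car C) @ [sp I A]"
  let ?\<pi> = "Der 0 (LolliL (occurrences A S) (Ax A))"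
  have concl: "concl (occurrences A S) = A" and len: "length (ctx (occurrences A S)) = length ?Vs"
    using seq_occurrences[of A S] by simp_all
  have sub': "\<forall>X\<in>set (car C # ?Vs). subspace X"
    using sub by auto
  have ml: "multilinear_on scale (car C # ?Vs) (sp I A) (den scale I ?\<pi>)"
    using multilinear_on_apply[of "sp I A" "sp I A" I "occurrences A S" A "car C" ?Vs]
      hom der Cons.IH(1) len sub' sub(2) concl by (simp only: C_def)
  have den: "den scale I ?\<pi> (x # replicate ?n0 x0 @ replicate ?n1 x1 @ [a]) =
      app I A A (der I (Lolli A A) x)
        (foldr (\<lambda>b. app I A A (der I (Lolli A A) (if b then x1 else x0))) S a)" for x
    using den_apply[of "replicate ?n0 x0 @ replicate ?n1 x1 @ [a]" "occurrences A S" I A x]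
      len concl Cons.IH(2) by (simp del: den.simps)
  {
    case 1
    have "multilinear_on scale ([] @ car C # replicate ?n0 (car C) @ replicate ?n1 (car C) @ [sp I A])
        (sp I A) (den scale I ?\<pi>)"
      using ml by (simp only: append_Nil)
    from multilinear_on_move_right[OF this] sub'
    have "multilinear_on scale (replicate ?n0 (car C) @ car C # replicate ?n1 (car C) @ [sp I A])
        (sp I A) (den scale I (move_right 0 ?n0 ?\<pi>))"
      by (simp only: append_Nil list.size length_replicate)
    then show ?case
      using ml by (cases b) (simp_all add: Let_def del: den.simps)
  next
    case 2
    have "den scale I (move_right 0 ?n0 ?\<pi>) (replicate ?n0 x0 @ x1 # replicate ?n1 x1 @ [a]) =
        den scale I ?\<pi> (x1 # replicate ?n0 x0 @ replicate ?n1 x1 @ [a])"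
      using den_move_right[of 0 "[]" I "replicate ?n0 x0" ?\<pi> x1 "replicate ?n1 x1 @ [a]"]
      by (simp only: append_Nil list.size length_replicate)
    then show ?case
      by (cases b) (simp_all add: Let_def den del: den.simps)
  }
qed

text \<open>Three evaluations undo the three abstractions, and the body is then computed at
  group-like elements by \<open>den_contract\<close> and \<open>den_occurrences\<close>. The list is
  reversed because the first digit of S is applied innermost.\<close>

lemma
  fixes I :: "('p, 'a, 'b) semantics" and A :: "'p form" and S :: "bool list"
  defines "E \<equiv> Lolli A A"
  defines "C \<equiv> bang I E"
  defines "f \<equiv> den scale I (binary_integer A S) []"
  assumes sem: "sweedler_semantics scale I (bint A)"
  shows den_binary_integer_in: "f \<in> sp I (bint A)"
    and den_binary_integer_grouplike:
      "(\<And>b. x b \<in> car C \<and> counit C (x b) = 1 \<and> comul C (x b) = tn C (x b) (x b)) \<Longrightarrow> a \<in> sp I A \<Longrightarrow>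
       app I A A (app I (Bang E) E (app I (Bang E) (Lolli (Bang E) E) f (x False)) (x True)) a =
       foldr (\<lambda>b. app I A A (der I E (x b))) (rev S) a"
proof -
  let ?E = "Bang E" and ?V = "sp I A"
  have semE: "sweedler_semantics scale I E" and semC: "sweedler_semantics scale I ?E"
    using sem by (simp_all add: bint_def E_def)
  have cofree: "is_cofree scale (sp I E) C (der I E)" and sp: "sp I ?E = car C"
    using semC by (simp_all add: C_def)
  have hom0: "is_hom_space scale ?V ?V (sp I E) (app I A A)"
    using semE by (simp add: E_def)
  have hom1: "is_hom_space scale (car C) (sp I E) (sp I (Lolli ?E E)) (app I ?E E)"
    and hom2: "is_hom_space scale (car C) (sp I (Lolli ?E E)) (sp I (bint A)) (app I ?E (Lolli ?E E))"
    using sem unfolding sp[symmetric] bint_def E_def sweedler_semantics.simps by blast+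
  have C: "cocomm_coalgebra scale C" and der: "restrict (der I E) (car C) \<in> linmaps scale scale (car C) (sp I E)"
    using cofree by (simp_all add: is_cofree_def)
  have subV: "subspace ?V" using semE subspace_sp[of I A] by (simp add: E_def)
  have subC: "subspace (car C)" using cocomm_coalgebraD(1)[OF C] .
  let ?n = "\<lambda>b. count_list (rev S) b"
  have count: "?n b = count_list S b" for b
    by (induction S) auto
  define \<pi>0 where "\<pi>0 = occurrences A (rev S)"
  define \<pi>1 where "\<pi>1 = contract 0 E (?n False) \<pi>0"
  define \<pi>2 where "\<pi>2 = contract 1 E (?n True) \<pi>1"
  note C' = C[unfolded C_def]
  have ml0: "multilinear_on scale ([] @ replicate (?n False) (car C) @ replicate (?n True) (car C) @ [?V])
      ?V (den scale I \<pi>0)"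
    using multilinear_on_occurrences[of I A "rev S"] hom0 der subC subV
    by (simp add: \<pi>0_def C_def E_def)
  have sub0: "\<forall>X\<in>set ([] @ replicate (?n True) (car C) @ [?V]). subspace X"
    using subC subV by auto
  have ml1: "multilinear_on scale ([car C] @ replicate (?n True) (car C) @ [?V]) ?V (den scale I \<pi>1)"
    using multilinear_on_contract[OF C' subV, folded C_def, OF sub0 _ ml0, of 0] by (simp add: \<pi>1_def)
  have sub1: "\<forall>X\<in>set ([car C] @ [?V]). subspace X"
    using subC subV by auto
  have ml2: "multilinear_on scale ([car C, car C] @ [?V]) ?V (den scale I \<pi>2)"
    using multilinear_on_contract[OF C' subV, folded C_def, OF sub1 _ ml1, of 1] by (simp add: \<pi>2_def)
  \<comment> \<open>The denotation of \<open>LolliR\<close> reads the bound formula off the sequent,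
    so the contexts are needed to identify the hom spaces involved.\<close>
  have seq0: "valid \<pi>0 \<and> seq \<pi>0 = ([] @ replicate (?n False) ?E @ replicate (?n True) ?E @ [A], A)"
    using seq_occurrences[of A "rev S"] by (simp add: \<pi>0_def E_def)
  then have seq1: "valid \<pi>1 \<and> seq \<pi>1 = ([?E] @ replicate (?n True) ?E @ [A], A)"
    using seq_contract[of \<pi>0 "[]" "?n False" E _ 0] by (simp add: \<pi>1_def)
  then have seq2: "seq \<pi>2 = ([?E, ?E, A], A)"
    using seq_contract[of \<pi>1 "[?E]" "?n True" E "[A]" 1] by (simp add: \<pi>2_def)
  \<comment> \<open>\<open>f2\<close> abstracts a, and \<open>f1\<close> also abstracts
    \<open>u\<^sub>1\<close>; abstracting \<open>u\<^sub>0\<close> as well gives f.\<close>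
  define f2 where "f2 = den scale I (LolliR \<pi>2)"
  define f1 where "f1 = den scale I (LolliR (LolliR \<pi>2))"
  have f2: "f2 = (\<lambda>xs. inv_into (sp I E) (app I A A) (\<lambda>a\<in>?V. den scale I \<pi>2 (xs @ [a])))"
    using seq2 by (simp add: f2_def E_def Let_def)
  have f1: "f1 = (\<lambda>xs. inv_into (sp I (Lolli ?E E)) (app I ?E E) (\<lambda>a\<in>car C. f2 (xs @ [a])))"
    using seq2 by (simp add: f1_def f2_def sp[symmetric] E_def Let_def)
  have f: "f = inv_into (sp I (bint A)) (app I ?E (Lolli ?E E)) (\<lambda>a\<in>car C. f1 ([] @ [a]))"
    using seq2 count by (simp add: f_def f1_def binary_integer_def \<pi>0_def \<pi>1_def \<pi>2_def sp[symmetric] E_def bint_def Let_def)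
  have sub2: "\<forall>X\<in>set ([car C, car C] @ [?V]). subspace X"
    using subC subV by simp
  have mlf2: "multilinear_on scale ([car C] @ [car C]) (sp I E) f2"
    using multilinear_on_curry[OF hom0 ml2 sub2] by (simp add: f2)
  have sub3: "\<forall>X\<in>set ([car C] @ [car C]). subspace X" "\<forall>X\<in>set ([] @ [car C]). subspace X"
    using subC by simp_all
  have mlf1: "multilinear_on scale ([] @ [car C]) (sp I (Lolli ?E E)) f1"
    using multilinear_on_curry[OF hom1 mlf2 sub3(1)] by (simp add: f1)
  show "f \<in> sp I (bint A)"
    using multilinear_on_value[OF multilinear_on_curry[OF hom2 mlf1 sub3(2)], of "[]"] by (simp add: f)
  assume x: "\<And>b. x b \<in> car C \<and> counit C (x b) = 1 \<and> comul C (x b) = tn C (x b) (x b)"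
    and a: "a \<in> ?V"
  have "app I ?E (Lolli ?E E) f (x False) = f1 [x False]"
    using ev_curry[OF hom2 mlf1 sub3(2), of "[]"] x by (simp add: f)
  moreover have "app I ?E E (f1 [x False]) (x True) = f2 [x False, x True]"
    using ev_curry[OF hom1 mlf2 sub3(1), of "[x False]"] x by (simp add: f1)
  moreover have "app I A A (f2 [x False, x True]) a = den scale I \<pi>2 [x False, x True, a]"
    using ev_curry[OF hom0 ml2 sub2, of "[x False, x True]"] x a by (simp add: f2)
  \<comment> \<open>The copies of \<open>u\<^sub>1\<close> were merged last, so they are expanded
    first, while \<open>u\<^sub>0\<close> is still a single argument.\<close>
  moreover have "den scale I \<pi>2 [x False, x True, a] = den scale I \<pi>1 ([x False] @ replicate (?n True) (x True) @ [a])"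
    using den_contract[OF C' subV, folded C_def, OF sub1 _ ml1, of 1 "[x False]" "[a]" "x True"] x a
    by (simp add: \<pi>2_def)
  moreover have "list_all2 (\<in>) (replicate (?n True) (x True) @ [a]) (replicate (?n True) (car C) @ [?V])"
    using x a by (intro list_all2_appendI) (auto simp: list_all2_conv_all_nth)
  then have "den scale I \<pi>1 ([x False] @ replicate (?n True) (x True) @ [a]) =
      den scale I \<pi>0 (replicate (?n False) (x False) @ replicate (?n True) (x True) @ [a])"
    using den_contract[OF C' subV, folded C_def, OF sub0 _ ml0, of 0 "[]" _ "x False"] x
    by (simp add: \<pi>1_def)
  moreover have "den scale I \<pi>0 (replicate (?n False) (x False) @ replicate (?n True) (x True) @ [a]) =
      foldr (\<lambda>b. app I A A (der I E (if b then x True else x False))) (rev S) a"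
    using den_occurrences[of I A "rev S" "x False" "x True" a] hom0 der subC subV
    by (simp add: \<pi>0_def C_def E_def)
  moreover have "(if b then x True else x False) = x b" for b
    by simp
  ultimately show "app I A A (app I ?E E (app I ?E (Lolli ?E E) f (x False)) (x True)) a =
      foldr (\<lambda>b. app I A A (der I E (x b))) (rev S) a"
    by simp
qed

section \<open>Separating binary integers\<close>

text \<open>Horner's rule as an endomorphism: \<alpha> b doubles e1 and sends e2 to e2 plus 1 or 2
  times e1, so n e1 + e2 goes to (2 n + 1) e1 + e2 or (2 n + 2) e1 + e2. Coordinates refer to the
  basis B, which may be infinite; its other elements are sent to 0.\<close>

lemma digit_endomorphisms:
  assumes "independent B" "span B = V" "e1 \<in> B" "e2 \<in> B" "e1 \<noteq> e2"
  obtains \<alpha> :: "bool \<Rightarrow> 'b \<Rightarrow> 'b" where "\<And>b. \<alpha> b \<in> linmaps scale scale V V"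
    "\<And>S. foldr \<alpha> S e2 = of_nat (bijective_binary S) *s e1 + e2"
proof
  let ?r = "\<lambda>e v. representation B v e"
  let ?\<alpha> = "\<lambda>b. \<lambda>v\<in>V. (2 * ?r e1 v + (if b then 2 else 1) * ?r e2 v) *s e1 + ?r e2 v *s e2"
  have V: "subspace V" and e: "e1 \<in> V" "e2 \<in> V" using assms span_base by auto
  have r: "v \<in> V \<Longrightarrow> w \<in> V \<Longrightarrow> ?r e (v + w) = ?r e v + ?r e w"
    "v \<in> V \<Longrightarrow> ?r e (c *s v) = c * ?r e v" for v w c e
    using assms(1,2) by (simp_all add: representation_add representation_scale)
  show "?\<alpha> b \<in> linmaps scale scale V V" for b
    using V e by (simp add: restrict_in_linmaps_iff r subspace_add subspace_scale algebra_simps)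
  have re: "?r e1 e1 = 1" "?r e1 e2 = 0" "?r e2 e1 = 0" "?r e2 e2 = 1"
    using assms by (simp_all add: representation_basis)
  show "foldr ?\<alpha> S e2 = of_nat (bijective_binary S) *s e1 + e2" for S
  proof (induction S)
    case (Cons b S)
    \<comment> \<open>\<alpha> b is given by its formula on V only, and the coordinates are linear
      there.\<close>
    have "of_nat (bijective_binary S) *s e1 + e2 \<in> V"
      using V e by (simp add: subspace_add subspace_scale)
    then show ?case
      using Cons V e by (simp add: r re subspace_scale algebra_simps)
  qed simp
qed

end

theorem propositionB12:
  fixes s :: "'k::{alg_closed_field, field_char_0} \<Rightarrow> 'u::ab_group_add \<Rightarrow> 'u"
    and I :: "('p, 'k, 'u) semantics"
    and A :: "'p form"
  assumes "vector_space s"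
    and "sweedler_semantics s I (bint A)"
    and "dim_ge s 2 (sp I A)"
  shows "(\<lambda>S. den s I (binary_integer A S) []) \<in> UNIV \<rightarrow> sp I (bint A) \<and>
    inj (\<lambda>S. den s I (binary_integer A S) [])"
proof
  interpret vs: vector_space s by fact
  let ?E = "Lolli A A"
  let ?C = "bang I ?E"
  show "(\<lambda>S. den s I (binary_integer A S) []) \<in> UNIV \<rightarrow> sp I (bint A)"
    using vs.den_binary_integer_in[OF assms(2)] by simp
  have hom: "is_hom_space s (sp I A) (sp I A) (sp I ?E) (app I A A)"
    and cofree: "is_cofree s (sp I ?E) ?C (der I ?E)"
    using assms(2) by (simp_all add: bint_def)
  obtain B where B: "vs.independent B" "vs.span B = sp I A" "infinite B \<or> 2 \<le> card B"
    using assms(3) by (auto simp: dim_ge_def)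
  \<comment> \<open>An infinite basis contains a two-element subset too, so both alternatives of
    \<open>dim_ge\<close> lead to e1 and e2.\<close>
  then obtain B' where "B' \<subseteq> B" "card B' = 2"
    by (metis infinite_arbitrarily_large obtain_subset_with_card_n)
  then obtain e1 e2 where e: "e1 \<in> B" "e2 \<in> B" "e1 \<noteq> e2"
    by (auto simp: card_2_iff)
  \<comment> \<open>e1 \<noteq> 0 serves twice: its line carries the coalgebra that yields
    group-like elements, and at the end its coefficients are compared.\<close>
  then have "e1 \<noteq> 0" and e2: "e2 \<in> sp I A"
    using B vs.dependent_zero vs.span_base by auto
  obtain \<alpha> where \<alpha>: "\<And>b. \<alpha> b \<in> linmaps s s (sp I A) (sp I A)"
    and fold: "\<And>S. foldr \<alpha> S e2 = s (of_nat (bijective_binary S)) e1 + e2"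
    using vs.digit_endomorphisms[OF B(1,2) e] by metis
  \<comment> \<open>The point of \<open>sp I ?E\<close> below x is the element that stands for
    \<alpha> b.\<close>
  have "\<exists>x\<in>car ?C. app I A A (der I ?E x) = \<alpha> b \<and> counit ?C x = 1 \<and> comul ?C x = tn ?C x x" for b
  proof -
    have "vs.subspace (sp I ?E)" and "\<alpha> b \<in> app I A A ` sp I ?E"
      using hom \<alpha> by (auto simp: is_hom_space_def bij_betw_def)
    then show ?thesis
      using vs.cofree_grouplike[OF cofree _ _ \<open>e1 \<noteq> 0\<close>] by (metis (no_types, lifting) imageE)
  qed
  then obtain x where x: "\<And>b. x b \<in> car ?C \<and> counit ?C (x b) = 1 \<and> comul ?C (x b) = tn ?C (x b) (x b)"
    and app: "\<And>b. app I A A (der I ?E (x b)) = \<alpha> b"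
    by metis
  show "inj (\<lambda>S. den s I (binary_integer A S) [])"
  proof (rule injI)
    fix S T assume "den s I (binary_integer A S) [] = den s I (binary_integer A T) []"
    then have "foldr (\<lambda>b. app I A A (der I ?E (x b))) (rev S) e2 =
        foldr (\<lambda>b. app I A A (der I ?E (x b))) (rev T) e2"
      using vs.den_binary_integer_grouplike[OF assms(2), of x e2] x e2 by metis
    then have "foldr \<alpha> (rev S) e2 = foldr \<alpha> (rev T) e2"
      by (simp add: app)
    \<comment> \<open>Cancelling e2 leaves two multiples of e1 \<noteq> 0, and \<open>of_nat\<close>
      is injective in characteristic zero.\<close>
    then have "bijective_binary (rev S) = bijective_binary (rev T)"
      using \<open>e1 \<noteq> 0\<close> by (simp add: fold)
    then show "S = T"
      using inj_bijective_binary by (metis injD rev_rev_ident)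
  qed
qed

end
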